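(* Let $A=\{0,1,2,3\}$. The number of centralising monoids on $A$ with majority witnesses is exactly $1\,715$; that is, the set $$\bigl\{F^{*(1)} : F\subseteq \mathrm{Maj}_A\bigr\}$$ of subsets of $A^A$ has exactly $1\,715$ elements.
   Context: A majority operation on $A$ is a function $f\colon A^3\to A$ with $f(x,x,y)=f(x,y,x)=f(y,x,x)=x$ for all $x,y\in A$; $\mathrm{Maj}_A$ is the set of all majority operations on $A$. A unary function $s\colon A\to A$ commutes with $f\colon A^3\to A$, written $f\perp s$, if $s(f(x,y,z))=f(s(x),s(y),s(z))$ for all $x,y,z\in A$. For $F\subseteq \mathrm{Maj}_A$ let $F^{*(1)}=\{s\colon A\to A : s\perp f\text{ for all } f\in F\}$. A centralising monoid with majority witnesses is a set of the form $F^{*(1)}$ for some $F\subseteq\mathrm{Maj}_A$; here $F=\emptyset$ is allowed, so the full transformation monoid $A^A$ is counted. *)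

theory Defs
  imports "HOL-Library.FuncSet"
begin

text \<open>
  Operations on a carrier set \<open>A\<close> are extensional functions (constantly \<open>undefined\<close> outside their
  domain), so that each function \<open>A\<^sup>3 \<rightarrow> A\<close> or \<open>A \<rightarrow> A\<close> is represented by exactly one HOL function.
\<close>

definition Maj :: "'a set \<Rightarrow> ('a \<times> 'a \<times> 'a \<Rightarrow> 'a) set" where
  "Maj A = {f \<in> A \<times> A \<times> A \<rightarrow>\<^sub>E A.
     \<forall>x\<in>A. \<forall>y\<in>A. f (x, x, y) = x \<and> f (x, y, x) = x \<and> f (y, x, x) = x}"

definition commutes :: "'a set \<Rightarrow> ('a \<times> 'a \<times> 'a \<Rightarrow> 'a) \<Rightarrow> ('a \<Rightarrow> 'a) \<Rightarrow> bool" where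
  "commutes A f s \<longleftrightarrow> (\<forall>x\<in>A. \<forall>y\<in>A. \<forall>z\<in>A. s (f (x, y, z)) = f (s x, s y, s z))"

definition unary_centraliser :: "'a set \<Rightarrow> ('a \<times> 'a \<times> 'a \<Rightarrow> 'a) set \<Rightarrow> ('a \<Rightarrow> 'a) set" where
  "unary_centraliser A F = {s \<in> A \<rightarrow>\<^sub>E A. \<forall>f\<in>F. commutes A f s}"

definition maj_centralising_monoids :: "'a set \<Rightarrow> ('a \<Rightarrow> 'a) set set" where
  "maj_centralising_monoids A = {unary_centraliser A F | F. F \<subseteq> Maj A}"

end

theory Submission
  imports Defs
begin

text \<open>
  Constant maps commute with every majority operation, and whether a map with two values commutes
  with one depends only on its kernel. So a centralising monoid is determined by its trace on 174
  maps: the nontrivial permutations, the maps with three values, and one map for each of the seven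
  kernels with two blocks.

  The symmetric group on four points acts on everything by conjugation. There are 142 orbits of
  centralising monoids; 141 of them contain the monoid \<open>{f}\<^sup>*\<close> of a single explicit majority
  operation, the remaining one is the full transformation monoid. Counting the conjugates of these
  141 traces gives 1714 different monoids.

  That there are no others is shown by exhausting extensions: if the monoid \<open>F\<^sup>*\<close> of a nonempty
  \<open>F\<close> properly contains one of the 141 traces \<open>R\<close>, it contains one of the 1714 traces that is
  strictly larger than \<open>R\<close>. For this, each map \<open>s\<close> outside \<open>R\<close> is added to \<open>R\<close> and the result is
  closed under composition and under 30 implications (up to conjugation) of the form ``a majority
  operation commuting with all maps in \<open>P\<close> commutes with \<open>n\<close>'' or ``no majority operation
  commutes with all maps in \<open>P\<close>'', until a contradiction, a map treated before \<open>s\<close>, or one of the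
  1714 traces is reached.
\<close>

section \<open>Maps and majority operations on four points\<close>

datatype four = A0 | A1 | A2 | A3

lemma four_cases: "x = A0 \<or> x = A1 \<or> x = A2 \<or> x = A3"
  by (cases x) auto

lemma all_four: "(\<forall>x. P x) \<longleftrightarrow> P A0 \<and> P A1 \<and> P A2 \<and> P A3"
  by (metis four.exhaust)

datatype map4 = M four four four four

fun ap :: "map4 \<Rightarrow> four \<Rightarrow> four" where
  "ap (M a b c d) A0 = a"
| "ap (M a b c d) A1 = b"
| "ap (M a b c d) A2 = c"
| "ap (M a b c d) A3 = d"

fun comp :: "map4 \<Rightarrow> map4 \<Rightarrow> map4" where
  "comp s (M a b c d) = M (ap s a) (ap s b) (ap s c) (ap s d)"

definition idm :: map4 where
  "idm = M A0 A1 A2 A3"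

lemma map4_eqI: "(\<And>x. ap s x = ap t x) \<Longrightarrow> s = t"
  by (cases s; cases t) (metis ap.simps)

lemma ap_comp [simp]: "ap (comp s t) x = ap s (ap t x)"
  by (cases t; cases x) simp_all

lemma ap_idm [simp]: "ap idm x = x"
  by (cases x) (simp_all add: idm_def)

lemma comp_assoc: "comp (comp s t) u = comp s (comp t u)"
  by (rule map4_eqI) simp

lemma comp_idm [simp]: "comp idm s = s" "comp s idm = s"
  by (rule map4_eqI, simp)+

type_synonym op3 = "four \<Rightarrow> four \<Rightarrow> four \<Rightarrow> four"

definition maj :: "op3 \<Rightarrow> bool" where
  "maj f \<longleftrightarrow> (\<forall>x y. f x x y = x \<and> f x y x = x \<and> f y x x = x)"

lemma majD:
  assumes "maj f"
  shows "f x x y = x" "f x y x = x" "f y x x = x"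
  using assms by (auto simp: maj_def)

definition com :: "op3 \<Rightarrow> map4 \<Rightarrow> bool" where
  "com f s \<longleftrightarrow> (\<forall>x y z. ap s (f x y z) = f (ap s x) (ap s y) (ap s z))"

lemma com_comp: "com f s \<Longrightarrow> com f t \<Longrightarrow> com f (comp s t)"
  by (simp add: com_def)

lemma com_idm: "com f idm"
  by (simp add: com_def)

definition const :: "map4 \<Rightarrow> bool" where
  "const s \<longleftrightarrow> (\<forall>x y. ap s x = ap s y)"

text \<open>Majority operations are idempotent, so both sides equal the single value of
  \<open>s\<close>.\<close>

lemma com_const:
  assumes "maj f" "const s"
  shows "com f s"
  unfolding com_def
proof (intro allI)
  fix x y z
  have "ap s y = ap s x" "ap s z = ap s x" "ap s (f x y z) = ap s x"
    using assms(2) unfolding const_def by blast+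
  with assms(1) show "ap s (f x y z) = f (ap s x) (ap s y) (ap s z)"
    by (simp add: maj_def)
qed

definition two_valued :: "map4 \<Rightarrow> bool" where
  "two_valued s \<longleftrightarrow> (\<forall>x y z. ap s x = ap s y \<or> ap s x = ap s z \<or> ap s y = ap s z)"

definition same_kernel :: "map4 \<Rightarrow> map4 \<Rightarrow> bool" where
  "same_kernel s t \<longleftrightarrow> (\<forall>x y. ap s x = ap s y \<longleftrightarrow> ap t x = ap t y)"

lemma two_valued_cong: "same_kernel s t \<Longrightarrow> two_valued s \<longleftrightarrow> two_valued t"
  by (simp add: two_valued_def same_kernel_def)

text \<open>Two of the values of \<open>s\<close> at the three arguments coincide, so commuting only
  says that \<open>f x y z\<close> lies in the kernel class of the arguments sharing that value.
  This condition depends on the kernel alone.\<close>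

lemma com_two_valued:
  assumes "maj f" "com f s" "two_valued s" "same_kernel s t"
  shows "com f t"
  unfolding com_def
proof (intro allI)
  fix x y z
  have *: "ap s (f x y z) = f (ap s x) (ap s y) (ap s z)"
    using assms(2) by (simp add: com_def)
  consider "ap s x = ap s y" | "ap s x = ap s z" | "ap s y = ap s z"
    using assms(3) unfolding two_valued_def by blast
  then show "ap t (f x y z) = f (ap t x) (ap t y) (ap t z)"
  proof cases
    case 1
    with * assms(1) have "ap s (f x y z) = ap s x" by (simp add: maj_def)
    with 1 assms(4) have "ap t (f x y z) = ap t x" "ap t x = ap t y"
      unfolding same_kernel_def by blast+
    with assms(1) show ?thesis by (simp add: maj_def)
  next
    case 2
    with * assms(1) have "ap s (f x y z) = ap s x" by (simp add: maj_def)
    with 2 assms(4) have "ap t (f x y z) = ap t x" "ap t x = ap t z"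
      unfolding same_kernel_def by blast+
    with assms(1) show ?thesis by (simp add: maj_def)
  next
    case 3
    with * assms(1) have "ap s (f x y z) = ap s y" by (simp add: maj_def)
    with 3 assms(4) have "ap t (f x y z) = ap t y" "ap t y = ap t z"
      unfolding same_kernel_def by blast+
    with assms(1) show ?thesis by (simp add: maj_def)
  qed
qed

section \<open>Normal forms and conjugation\<close>

text \<open>The definitions below are evaluated by rewriting, which re-examines a whole branch whenever an
  \<open>if\<close> or \<open>case\<close> is decided and looks at all arguments of a function in every step. This is why
  conditions are passed to auxiliary functions defined by pattern matching, and why large tables
  are kept out of the inner loops.\<close>

fun same :: "four \<Rightarrow> four \<Rightarrow> bool" where
  "same A0 A0 = True"
| "same A0 A1 = False"
| "same A0 A2 = False"
| "same A0 A3 = False"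
| "same A1 A0 = False"
| "same A1 A1 = True"
| "same A1 A2 = False"
| "same A1 A3 = False"
| "same A2 A0 = False"
| "same A2 A1 = False"
| "same A2 A2 = True"
| "same A2 A3 = False"
| "same A3 A0 = False"
| "same A3 A1 = False"
| "same A3 A2 = False"
| "same A3 A3 = True"

lemma same_iff [simp]: "same a b \<longleftrightarrow> a = b"
  by (cases a; cases b) simp_all

fun pick :: "bool \<Rightarrow> 'a \<Rightarrow> 'a \<Rightarrow> 'a" where
  "pick True x y = x"
| "pick False x y = y"

lemma pick_eq [simp]: "pick b x y = (if b then x else y)"
  by (cases b) simp_all

fun cons_if :: "bool \<Rightarrow> 'a \<Rightarrow> 'a list \<Rightarrow> 'a list" where
  "cons_if True x xs = x # xs"
| "cons_if False x xs = xs"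

lemma cons_if_eq [simp]: "cons_if b x xs = (if b then x # xs else xs)"
  by (cases b) simp_all

text \<open>Constant maps are normalised to the identity, which also commutes with everything; maps with two
  values are normalised to an idempotent map with the same kernel.\<close>

fun nrm_by :: "bool \<Rightarrow> bool \<Rightarrow> bool \<Rightarrow> bool \<Rightarrow> bool \<Rightarrow> bool \<Rightarrow> map4 \<Rightarrow> map4" where
  "nrm_by True True True bc bd cd s = M A0 A1 A2 A3"
| "nrm_by True True False bc bd cd s = M A0 A0 A0 A3"
| "nrm_by True False True bc bd cd s = M A0 A0 A2 A0"
| "nrm_by True False False bc bd True s = M A0 A0 A2 A2"
| "nrm_by True False False bc bd False s = s"
| "nrm_by False True True bc bd cd s = M A0 A1 A0 A0"
| "nrm_by False True False bc True cd s = M A0 A1 A0 A1"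
| "nrm_by False True False bc False cd s = s"
| "nrm_by False False True True bd cd s = M A0 A1 A1 A0"
| "nrm_by False False True False bd cd s = s"
| "nrm_by False False False True True cd s = M A0 A1 A1 A1"
| "nrm_by False False False True False cd s = s"
| "nrm_by False False False False bd cd s = s"

fun nrm :: "map4 \<Rightarrow> map4" where
  "nrm (M a b c d) =
    nrm_by (same a b) (same a c) (same a d) (same b c) (same b d) (same c d) (M a b c d)"

lemma nrm_cases:
  obtains "nrm s = s"
  | "const s" "nrm s = idm"
  | "two_valued s" "same_kernel (nrm s) s"
proof (cases s)
  case (M a b c d)
  then have "nrm s = s \<or> (const s \<and> nrm s = idm) \<or> (two_valued s \<and> same_kernel (nrm s) s)"
    by (cases "a = b"; cases "a = c"; cases "a = d"; cases "b = c"; cases "b = d"; cases "c = d")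
       (simp_all add: const_def two_valued_def same_kernel_def all_four idm_def)
  then show thesis
    using that by blast
qed

lemma nrm_const: "const s \<Longrightarrow> nrm s = idm"
proof (cases s)
  case (M a b c d)
  assume "const s"
  then have "ap s A0 = ap s A1" "ap s A0 = ap s A2" "ap s A0 = ap s A3"
    unfolding const_def by blast+
  then show "nrm s = idm"
    unfolding M ap.simps by (simp add: idm_def)
qed

lemma nrm_same_kernel:
  assumes "same_kernel s t" "two_valued s"
  shows "nrm s = nrm t"
proof (cases s; cases t)
  fix a b c d a' b' c' d'
  assume s: "s = M a b c d" and t: "t = M a' b' c' d'"
  have eqs: "a = b \<longleftrightarrow> a' = b'" "a = c \<longleftrightarrow> a' = c'" "a = d \<longleftrightarrow> a' = d'"
    "b = c \<longleftrightarrow> b' = c'" "b = d \<longleftrightarrow> b' = d'" "c = d \<longleftrightarrow> c' = d'"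
    using assms(1) unfolding s t same_kernel_def all_four ap.simps by blast+
  have "a = b \<or> a = c \<or> b = c" "a = b \<or> a = d \<or> b = d" "a = c \<or> a = d \<or> c = d"
    "b = c \<or> b = d \<or> c = d"
    using assms(2) unfolding s two_valued_def by (metis ap.simps)+
  then show ?thesis
    unfolding s t nrm.simps same_iff eqs[symmetric]
    by (cases "a = b"; cases "a = c"; cases "a = d"; cases "b = c"; cases "b = d"; cases "c = d")
       simp_all
qed

text \<open>Conjugation by a permutation keeps maps constant or two-valued and respects equality of
  kernels. Hence the symmetric group acts on normal forms.\<close>

lemma nrm_comp_nrm: "nrm (comp p (comp (nrm t) q)) = nrm (comp p (comp t q))"
  if pq: "comp p q = idm"
proof (cases t rule: nrm_cases)
  case 1
  then show ?thesis by simp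
next
  case 2
  then have "const (comp p (comp t q))"
    unfolding const_def ap_comp by metis
  then show ?thesis
    using 2 pq nrm_const[of idm] by (simp add: nrm_const) (simp add: idm_def)
next
  case 3
  have inj: "ap p x = ap p y \<longleftrightarrow> x = y" if "comp q p = idm" for x y
    by (metis that ap_comp ap_idm)
  \<comment> \<open>The right inverse \<open>q\<close> makes \<open>p\<close> surjective; on a
    finite set \<open>p\<close> is then injective and \<open>q\<close> is a two-sided
    inverse.\<close>
  have "comp q p = idm"
  proof -
    have "surj (ap p)"
      by (metis pq ap_comp ap_idm surjI)
    moreover have "finite (UNIV :: four set)"
      by (rule finite_subset[of _ "{A0, A1, A2, A3}"]) (auto intro: four.exhaust)
    ultimately have "inj (ap p)"
      by (metis finite_UNIV_surj_inj)
    then show ?thesis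
      by (intro map4_eqI) (metis pq ap_comp ap_idm injD)
  qed
  note inj = inj[OF this]
  have "same_kernel (comp p (comp (nrm t) q)) (comp p (comp t q))"
    using 3(2) by (simp add: same_kernel_def inj)
  moreover have "two_valued (comp p (comp t q))"
    using 3(1) unfolding two_valued_def ap_comp inj by blast
  ultimately show ?thesis
    using nrm_same_kernel two_valued_cong by blast
qed

lemma nrm_idm [simp]: "nrm idm = idm"
  by (simp add: idm_def)

lemma nrm_nrm [simp]: "nrm (nrm s) = nrm s"
  using nrm_comp_nrm[of idm idm s] by simp

text \<open>This reduces every centraliser to its normal forms, that is, to its trace on
  \<open>univ\<close>.\<close>

lemma com_nrm:
  assumes "maj f"
  shows "com f (nrm s) \<longleftrightarrow> com f s"
proof (cases s rule: nrm_cases)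
  case 3
  have sym: "same_kernel s (nrm s)"
    using 3(2) by (simp add: same_kernel_def)
  show ?thesis
    using com_two_valued[OF assms _ _ 3(2)] com_two_valued[OF assms _ 3(1) sym]
      two_valued_cong[OF 3(2)] 3(1) by blast
qed (use assms com_const com_idm in auto)

section \<open>Conjugation of maps and operations by permutations\<close>

definition inverse_pair :: "map4 \<Rightarrow> map4 \<Rightarrow> bool" where
  "inverse_pair p q \<longleftrightarrow> comp p q = idm \<and> comp q p = idm"

lemma inverse_pair_ap:
  assumes "inverse_pair p q"
  shows "ap p (ap q x) = x" "ap q (ap p x) = x"
  using assms unfolding inverse_pair_def by (metis ap_comp ap_idm)+

lemma inverse_pair_comp:
  assumes "inverse_pair p q"
  shows "comp p (comp q s) = s" "comp q (comp p s) = s"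
  by (rule map4_eqI, simp add: inverse_pair_ap[OF assms])+

lemma inverse_pair_sym: "inverse_pair p q \<Longrightarrow> inverse_pair q p"
  by (simp add: inverse_pair_def)

text \<open>The inverse \<open>q\<close> is a separate argument so that it never has to be computed.
  The result is normalised because conjugation does not preserve the chosen representatives of
  two-block kernels.\<close>

definition conjugate :: "map4 \<Rightarrow> map4 \<Rightarrow> map4 \<Rightarrow> map4" where
  "conjugate p q s = nrm (comp p (comp s q))"

lemma conjugate_conjugate:
  assumes "inverse_pair p q"
  shows "conjugate p q (conjugate q p s) = nrm s"
  unfolding conjugate_def using assms
  by (simp add: nrm_comp_nrm inverse_pair_def comp_assoc inverse_pair_comp[OF assms])

lemma nrm_conjugate [simp]: "nrm (conjugate p q s) = conjugate p q s"
  by (simp add: conjugate_def)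

lemma conjugate_eq_idm:
  assumes "inverse_pair p q" "conjugate p q s = idm"
  shows "nrm s = idm"
proof -
  have "nrm s = conjugate q p (conjugate p q s)"
    using conjugate_conjugate[OF inverse_pair_sym[OF assms(1)]] by simp
  also have "\<dots> = idm"
    using assms by (simp add: conjugate_def inverse_pair_def)
  finally show ?thesis .
qed

text \<open>For \<open>q\<close> inverse to \<open>p\<close>, the permutation \<open>p\<close> is an
  isomorphism from the new operation to \<open>f\<close>.\<close>

definition twist :: "map4 \<Rightarrow> map4 \<Rightarrow> op3 \<Rightarrow> op3" where
  "twist p q f x y z = ap q (f (ap p x) (ap p y) (ap p z))"

lemma maj_twist: "inverse_pair p q \<Longrightarrow> maj f \<Longrightarrow> maj (twist p q f)"
  by (simp add: maj_def twist_def inverse_pair_ap)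

lemma com_twist:
  assumes "inverse_pair p q"
  shows "com (twist p q f) s \<longleftrightarrow> com f (comp p (comp s q))"
proof
  assume L: "com (twist p q f) s"
  show "com f (comp p (comp s q))"
    unfolding com_def
  proof (intro allI)
    fix x y z
    have "ap s (twist p q f (ap q x) (ap q y) (ap q z)) =
        twist p q f (ap s (ap q x)) (ap s (ap q y)) (ap s (ap q z))"
      using L by (simp add: com_def)
    then have "ap p (ap s (ap q (f x y z))) =
        ap p (ap q (f (ap p (ap s (ap q x))) (ap p (ap s (ap q y))) (ap p (ap s (ap q z)))))"
      by (simp add: twist_def inverse_pair_ap[OF assms])
    then show "ap (comp p (comp s q)) (f x y z) =
        f (ap (comp p (comp s q)) x) (ap (comp p (comp s q)) y) (ap (comp p (comp s q)) z)"
      by (simp add: inverse_pair_ap[OF assms])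
  qed
next
  assume R: "com f (comp p (comp s q))"
  show "com (twist p q f) s"
    unfolding com_def
  proof (intro allI)
    fix x y z
    have "ap (comp p (comp s q)) (f (ap p x) (ap p y) (ap p z)) =
        f (ap (comp p (comp s q)) (ap p x)) (ap (comp p (comp s q)) (ap p y))
          (ap (comp p (comp s q)) (ap p z))"
      using R by (simp add: com_def)
    then have "ap q (ap p (ap s (ap q (f (ap p x) (ap p y) (ap p z))))) =
        ap q (f (ap p (ap s x)) (ap p (ap s y)) (ap p (ap s z)))"
      by (simp add: inverse_pair_ap[OF assms])
    then show "ap s (twist p q f x y z) = twist p q f (ap s x) (ap s y) (ap s z)"
      by (simp add: twist_def inverse_pair_ap[OF assms])
  qed
qed

text \<open>Transport along the symmetric group, of rules as well as of traces, rests on this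
  exchange of a conjugated map for a twisted operation.\<close>

lemma com_conjugate:
  assumes "inverse_pair p q" "maj f"
  shows "com f (conjugate p q s) \<longleftrightarrow> com (twist p q f) s"
  by (simp add: conjugate_def com_nrm[OF assms(2)] com_twist[OF assms(1)])

lemma conjugate_comp:
  assumes "inverse_pair p q"
  shows "conjugate p q (conjugate p' q' s) = conjugate (comp p p') (comp q' q) s"
  using nrm_comp_nrm[of p q] assms by (simp add: conjugate_def inverse_pair_def comp_assoc)

section \<open>Implications between commutation conditions\<close>

text \<open>Premises and conclusion of an implication; the conclusion \<open>None\<close> stands for
  a contradiction.\<close>

type_synonym rule = "map4 list \<times> map4 option"

definition valid :: "rule \<Rightarrow> bool" where
  "valid r \<longleftrightarrow> (\<forall>f. maj f \<longrightarrow> (\<forall>s\<in>set (fst r). com f s) \<longrightarrow> (\<exists>n. snd r = Some n \<and> com f n))"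

fun conjugate_rule :: "map4 \<Rightarrow> map4 \<Rightarrow> rule \<Rightarrow> rule" where
  "conjugate_rule p q (P, r) = (map (conjugate p q) P, map_option (conjugate p q) r)"

text \<open>An operation satisfying the conjugated premises has a twist that satisfies the original
  ones and is again a majority operation. So one rule per orbit has to be proved.\<close>

lemma valid_conjugate:
  assumes "inverse_pair p q" "valid r"
  shows "valid (conjugate_rule p q r)"
proof (cases r)
  case (Pair P n)
  show ?thesis
    unfolding valid_def Pair conjugate_rule.simps
  proof (intro allI impI)
    fix f
    assume f: "maj f" "\<forall>s\<in>set (fst (map (conjugate p q) P, map_option (conjugate p q) n)). com f s"
    then have "\<forall>s\<in>set (fst r). com (twist p q f) s"
      using com_conjugate[OF assms(1)] Pair by auto
    then obtain k where "snd r = Some k" "com (twist p q f) k"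
      using assms(2) maj_twist[OF assms(1) f(1)] unfolding valid_def by blast
    then show "\<exists>k. snd (map (conjugate p q) P, map_option (conjugate p q) n) = Some k \<and> com f k"
      using com_conjugate[OF assms(1) f(1)] Pair by auto
  qed
qed

text \<open>The rules were found by computer; together with composition they make the search below succeed.\<close>

definition short_rules :: "rule list" where
  "short_rules =
    [([M A1 A0 A0 A2], Some (M A0 A1 A1 A3)),
     ([M A0 A0 A0 A3, M A0 A0 A2 A2], Some (M A3 A3 A2 A0)),
     ([M A0 A0 A1 A3, M A0 A1 A0 A3], Some (M A0 A2 A1 A3)),
     ([M A0 A0 A1 A3, M A0 A1 A1 A3], Some (M A0 A2 A2 A3)),
     ([M A0 A0 A2 A0, M A0 A0 A1 A2], Some (M A0 A0 A2 A1)),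
     ([M A0 A0 A2 A0, M A0 A0 A1 A3], Some (M A0 A0 A3 A1)),
     ([M A0 A0 A2 A1, M A1 A1 A0 A2], None),
     ([M A0 A0 A2 A2, M A0 A0 A2 A3], Some (M A1 A1 A2 A3)),
     ([M A0 A0 A2 A2, M A0 A1 A0 A1], Some (M A1 A0 A3 A2)),
     ([M A0 A0 A2 A2, M A0 A1 A0 A1], Some (M A1 A3 A0 A2)),
     ([M A0 A0 A2 A2, M A1 A2 A0 A0], None),
     ([M A0 A0 A3 A2, M A0 A1 A0 A3], Some (M A0 A0 A2 A1)),
     ([M A0 A0 A3 A2, M A0 A1 A2 A2], Some (M A0 A1 A3 A2)),
     ([M A0 A1 A0 A0, M A0 A0 A3 A2], Some (M A0 A1 A3 A2)),
     ([M A0 A1 A0 A3, M A0 A1 A1 A3], Some (M A0 A2 A2 A3)),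
     ([M A0 A1 A3 A2, M A0 A0 A2 A2], Some (M A0 A1 A2 A2)),
     ([M A0 A2 A3 A2, M A0 A3 A1 A1], Some (M A0 A2 A1 A1)),
     ([M A1 A0 A1 A2, M A1 A2 A1 A0], Some (M A0 A3 A0 A1)),
     ([M A1 A0 A3 A0, M A1 A2 A3 A2], Some (M A1 A0 A3 A2))]"

definition long_rules :: "rule list" where
  "long_rules =
    [([M A0 A0 A0 A3, M A0 A0 A2 A0, M A0 A0 A2 A3], Some (M A0 A0 A3 A2)),
     ([M A0 A0 A0 A3, M A0 A0 A2 A0, M A0 A1 A0 A0], Some (M A0 A0 A1 A2)),
     ([M A0 A0 A0 A3, M A0 A1 A0 A0, M A0 A0 A2 A3], Some (M A0 A3 A0 A1)),
     ([M A0 A0 A1 A2, M A0 A0 A1 A3, M A1 A1 A0 A2], Some (M A1 A1 A0 A3)),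
     ([M A0 A0 A1 A2, M A0 A0 A1 A3, M A1 A1 A0 A3], Some (M A1 A1 A0 A2)),
     ([M A0 A0 A1 A2, M A0 A0 A2 A3, M A1 A1 A0 A2], Some (M A2 A2 A0 A3)),
     ([M A0 A1 A1 A2, M A0 A1 A1 A3, M A0 A2 A2 A1], Some (M A0 A3 A3 A1)),
     ([M A0 A1 A1 A2, M A0 A1 A2 A2, M A0 A2 A1 A2], None),
     ([M A0 A0 A1 A2, M A0 A0 A3 A1, M A0 A0 A3 A2, M A1 A1 A3 A2], Some (M A0 A1 A3 A2)),
     ([M A0 A0 A3 A1, M A0 A0 A3 A2, M A1 A1 A0 A2, M A1 A1 A3 A2], Some (M A1 A3 A3 A2)),
     ([M A0 A2 A0 A1, M A0 A2 A0 A3, M A1 A0 A1 A3, M A1 A2 A1 A3], Some (M A2 A1 A0 A3))]"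

definition rules :: "rule list" where
  "rules = short_rules @ long_rules"

text \<open>The second hypothesis lists the possible values of each \<open>f x y z\<close>; once the
  quantifiers over \<open>four\<close> are expanded, every rule becomes a finite ground
  problem.\<close>

lemma valid_SomeI:
  "(\<And>f. maj f \<Longrightarrow> \<forall>x y z. f x y z = A0 \<or> f x y z = A1 \<or> f x y z = A2 \<or> f x y z = A3 \<Longrightarrow>
      \<forall>s\<in>set P. com f s \<Longrightarrow> com f n) \<Longrightarrow> valid (P, Some n)"
  using four_cases by (auto simp: valid_def)

lemma valid_NoneI:
  "(\<And>f. maj f \<Longrightarrow> \<forall>x y z. f x y z = A0 \<or> f x y z = A1 \<or> f x y z = A2 \<or> f x y z = A3 \<Longrightarrow>
      \<forall>s\<in>set P. com f s \<Longrightarrow> False) \<Longrightarrow> valid (P, None)"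
  using four_cases by (force simp: valid_def)

lemma short_rules_valid: "list_all valid short_rules"
  unfolding short_rules_def list.pred_inject(2)
  by (intro conjI list.pred_inject(1))
    ((rule valid_SomeI valid_NoneI; unfold com_def all_four list.set ball_simps;
      simp add: majD; smt (verit) four.distinct ap.simps)+)

lemma long_rules_valid: "list_all valid long_rules"
  unfolding long_rules_def list.pred_inject(2)
  by (intro conjI list.pred_inject(1))
    ((rule valid_SomeI valid_NoneI; unfold com_def all_four list.set ball_simps;
      simp add: majD; smt (verit) four.distinct ap.simps)+)

lemma rules_valid: "r \<in> set rules \<Longrightarrow> valid r"
  using short_rules_valid long_rules_valid by (auto simp: rules_def list_all_iff)

section \<open>Tries and ordered lists of maps\<close>

text \<open>Words over the four points index a tree with four-fold branching. It serves for sets of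
  maps, for sets of traces and for the rule table; the last needs a list of values, since many rules
  share a key.\<close>

datatype 'v trie = E | N "'v list" "'v trie" "'v trie" "'v trie" "'v trie"

fun lookup :: "four list \<Rightarrow> 'v trie \<Rightarrow> 'v list" where
  "lookup k E = []"
| "lookup [] (N v a b c d) = v"
| "lookup (A0 # k) (N v a b c d) = lookup k a"
| "lookup (A1 # k) (N v a b c d) = lookup k b"
| "lookup (A2 # k) (N v a b c d) = lookup k c"
| "lookup (A3 # k) (N v a b c d) = lookup k d"

fun upd :: "four list \<Rightarrow> 'v \<Rightarrow> 'v trie \<Rightarrow> 'v trie" where
  "upd [] w E = N [w] E E E E"
| "upd [] w (N v a b c d) = N (w # v) a b c d"
| "upd (A0 # k) w E = N [] (upd k w E) E E E"
| "upd (A1 # k) w E = N [] E (upd k w E) E E"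
| "upd (A2 # k) w E = N [] E E (upd k w E) E"
| "upd (A3 # k) w E = N [] E E E (upd k w E)"
| "upd (A0 # k) w (N v a b c d) = N v (upd k w a) b c d"
| "upd (A1 # k) w (N v a b c d) = N v a (upd k w b) c d"
| "upd (A2 # k) w (N v a b c d) = N v a b (upd k w c) d"
| "upd (A3 # k) w (N v a b c d) = N v a b c (upd k w d)"

fun merge :: "'v trie \<Rightarrow> 'v trie \<Rightarrow> 'v trie" where
  "merge E t = t"
| "merge (N v a b c d) E = N v a b c d"
| "merge (N v a b c d) (N v' a' b' c' d') =
    N (v @ v') (merge a a') (merge b b') (merge c c') (merge d d')"

fun subtrie :: "four list \<Rightarrow> 'v trie \<Rightarrow> 'v trie" where
  "subtrie k E = E"
| "subtrie [] (N v a b c d) = N v a b c d"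
| "subtrie (A0 # k) (N v a b c d) = subtrie k a"
| "subtrie (A1 # k) (N v a b c d) = subtrie k b"
| "subtrie (A2 # k) (N v a b c d) = subtrie k c"
| "subtrie (A3 # k) (N v a b c d) = subtrie k d"

text \<open>Repeated insertion only lengthens the value list of one node, and a node with values
  counts once. Coinciding conjugates are thus counted as a single set.\<close>

fun count_keys :: "'v trie \<Rightarrow> int \<Rightarrow> int" where
  "count_keys E n = n"
| "count_keys (N [] a b c d) n = count_keys d (count_keys c (count_keys b (count_keys a n)))"
| "count_keys (N (x # v) a b c d) n =
     count_keys d (count_keys c (count_keys b (count_keys a (n + 1))))"

lemma key_cases:
  obtains "k = []" | k' where "k = A0 # k'" | k' where "k = A1 # k'" | k' where "k = A2 # k'"
    | k' where "k = A3 # k'"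
  by (metis four.exhaust list.exhaust)

lemma lookup_upd [simp]: "lookup k (upd j w t) = (if k = j then w # lookup k t else lookup k t)"
proof (induction j arbitrary: t k)
  case Nil
  show ?case by (cases t; cases k rule: key_cases) simp_all
next
  case (Cons x j)
  show ?case by (cases x; cases t; cases k rule: key_cases) (simp_all add: Cons.IH)
qed

lemma lookup_merge [simp]: "lookup k (merge t u) = lookup k t @ lookup k u"
proof (induction t u arbitrary: k rule: merge.induct)
  case (3 v a b c d v' a' b' c' d')
  then show ?case by (cases k rule: key_cases) simp_all
qed simp_all

lemma lookup_subtrie [simp]: "lookup k (subtrie j t) = lookup (j @ k) t"
  by (induction j t rule: subtrie.induct) (cases k, simp_all)

definition keys :: "'v trie \<Rightarrow> four list set" where
  "keys t = {k. lookup k t \<noteq> []}"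

lemma keys_upd [simp]: "keys (upd k w t) = insert k (keys t)"
  by (auto simp: keys_def)

lemma keys_merge [simp]: "keys (merge t u) = keys t \<union> keys u"
  by (auto simp: keys_def)

lemma keys_E [simp]: "keys E = {}"
  by (simp add: keys_def)

lemma keys_N: "keys (N v a b c d) = (if v = [] then {} else {[]}) \<union>
    ((#) A0 ` keys a \<union> ((#) A1 ` keys b \<union> ((#) A2 ` keys c \<union> (#) A3 ` keys d)))" (is "?L = ?R")
proof (rule set_eqI)
  fix k
  show "k \<in> ?L \<longleftrightarrow> k \<in> ?R"
    by (cases k rule: key_cases) (auto simp: keys_def)
qed

lemma count_keys: "finite (keys t) \<and> count_keys t n = n + int (card (keys t))"
proof (induction t arbitrary: n)
  case (N v a b c d)
  have card_Cons: "card ((#) x ` K) = card K" for x :: four and K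
    by (rule card_image) simp
  have "card (keys (N v a b c d)) = (if v = [] then 0 else 1) +
      (card (keys a) + (card (keys b) + (card (keys c) + card (keys d))))"
    using N unfolding keys_N by (subst card_Un_disjoint, auto simp: card_Cons)+
  moreover have "finite (keys (N v a b c d))"
    using N by (simp add: keys_N)
  ultimately show ?case
    using N by (cases v) simp_all
qed simp

fun nonempty :: "'a list \<Rightarrow> bool" where
  "nonempty [] = False"
| "nonempty (x # xs) = True"

lemma nonempty_iff [simp]: "nonempty xs \<longleftrightarrow> xs \<noteq> []"
  by (cases xs) simp_all

fun digits :: "map4 \<Rightarrow> four list" where
  "digits (M a b c d) = [a, b, c, d]"

lemma digits_inject [simp]: "digits s = digits t \<longleftrightarrow> s = t"
  by (cases s; cases t) simp

definition mem :: "map4 \<Rightarrow> unit trie \<Rightarrow> bool" where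
  "mem s t = nonempty (lookup (digits s) t)"

definition add :: "map4 \<Rightarrow> unit trie \<Rightarrow> unit trie" where
  "add s t = upd (digits s) () t"

fun add_all :: "map4 list \<Rightarrow> unit trie \<Rightarrow> unit trie" where
  "add_all [] t = t"
| "add_all (s # ss) t = add_all ss (add s t)"

lemma mem_add [simp]: "mem s (add t T) \<longleftrightarrow> s = t \<or> mem s T"
  by (simp add: mem_def add_def)

lemma mem_E [simp]: "\<not> mem s E"
  by (simp add: mem_def)

lemma mem_add_all [simp]: "mem s (add_all X T) \<longleftrightarrow> s \<in> set X \<or> mem s T"
  by (induction X arbitrary: T) auto

section \<open>Total order on maps and canonical lists\<close>

datatype comparison = LESS | EQUAL | GREATER

fun cmp4 :: "four \<Rightarrow> four \<Rightarrow> comparison" where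
  "cmp4 A0 A0 = EQUAL"
| "cmp4 A0 A1 = LESS"
| "cmp4 A0 A2 = LESS"
| "cmp4 A0 A3 = LESS"
| "cmp4 A1 A0 = GREATER"
| "cmp4 A1 A1 = EQUAL"
| "cmp4 A1 A2 = LESS"
| "cmp4 A1 A3 = LESS"
| "cmp4 A2 A0 = GREATER"
| "cmp4 A2 A1 = GREATER"
| "cmp4 A2 A2 = EQUAL"
| "cmp4 A2 A3 = LESS"
| "cmp4 A3 A0 = GREATER"
| "cmp4 A3 A1 = GREATER"
| "cmp4 A3 A2 = GREATER"
| "cmp4 A3 A3 = EQUAL"

fun lexi :: "comparison \<Rightarrow> comparison \<Rightarrow> comparison" where
  "lexi LESS r = LESS"
| "lexi EQUAL r = r"
| "lexi GREATER r = GREATER"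

fun cmp :: "map4 \<Rightarrow> map4 \<Rightarrow> comparison" where
  "cmp (M a b c d) (M a' b' c' d') =
    lexi (cmp4 a a') (lexi (cmp4 b b') (lexi (cmp4 c c') (cmp4 d d')))"

fun ins :: "map4 \<Rightarrow> map4 list \<Rightarrow> map4 list"
  and ins_by :: "comparison \<Rightarrow> map4 \<Rightarrow> map4 \<Rightarrow> map4 list \<Rightarrow> map4 list" where
  "ins x [] = [x]"
| "ins x (y # ys) = ins_by (cmp x y) x y ys"
| "ins_by LESS x y ys = x # y # ys"
| "ins_by EQUAL x y ys = y # ys"
| "ins_by GREATER x y ys = y # ins x ys"

fun srt :: "map4 list \<Rightarrow> map4 list" where
  "srt [] = []"
| "srt (x # xs) = ins x (srt xs)"

fun rank4 :: "four \<Rightarrow> nat" where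
  "rank4 A0 = 0" | "rank4 A1 = 1" | "rank4 A2 = 2" | "rank4 A3 = 3"

fun number :: "map4 \<Rightarrow> nat" where
  "number (M a b c d) = 64 * rank4 a + (16 * rank4 b + (4 * rank4 c + rank4 d))"

lemma rank4_less: "rank4 a < 4"
  by (cases a) simp_all

definition compare_nat :: "nat \<Rightarrow> nat \<Rightarrow> comparison" where
  "compare_nat m n = (if m < n then LESS else if m = n then EQUAL else GREATER)"

text \<open>A remainder below \<open>m\<close> cannot outweigh a difference in the leading
  digit.\<close>

lemma lexi_compare_nat:
  assumes "r < m" "r' < m"
  shows "lexi (compare_nat a a') (compare_nat r r') = compare_nat (m * a + r) (m * a' + r')"
proof -
  have *: "m * x + y < m * x' + y'" if "x < x'" "y < m" for x x' y y'
  proof -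
    have "m * x + y < m * (x + 1)"
      using that by simp
    also have "\<dots> \<le> m * x'"
      using that by (intro mult_le_mono) auto
    finally show ?thesis by simp
  qed
  show ?thesis
    using *[of a a' r r'] *[of a' a r' r] assms by (auto simp: compare_nat_def)
qed

text \<open>The comparison used in evaluation is that of base-four numerals, so its order laws are
  inherited from \<open>nat\<close>.\<close>

lemma cmp_number: "cmp s t = compare_nat (number s) (number t)"
proof (cases s; cases t)
  fix a b c d a' b' c' d'
  assume s: "s = M a b c d" and t: "t = M a' b' c' d'"
  have 4: "cmp4 x y = compare_nat (rank4 x) (rank4 y)" for x y
    by (cases x; cases y) (simp_all add: compare_nat_def)
  have 16: "4 * rank4 c + rank4 d < 16" "4 * rank4 c' + rank4 d' < 16"
    using rank4_less[of c] rank4_less[of d] rank4_less[of c'] rank4_less[of d'] by linarith+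
  then have 64: "16 * rank4 b + (4 * rank4 c + rank4 d) < 64"
      "16 * rank4 b' + (4 * rank4 c' + rank4 d') < 64"
    using rank4_less[of b] rank4_less[of b'] by linarith+
  show ?thesis
    unfolding s t cmp.simps number.simps 4 lexi_compare_nat[OF rank4_less rank4_less]
      lexi_compare_nat[OF 16] lexi_compare_nat[OF 64] ..
qed

lemma cmp_eq_EQUAL: "cmp s t = EQUAL \<longleftrightarrow> s = t"
proof -
  have "lexi r r' = EQUAL \<longleftrightarrow> r = EQUAL \<and> r' = EQUAL" for r r'
    by (cases r) simp_all
  moreover have "cmp4 x y = EQUAL \<longleftrightarrow> x = y" for x y
    by (cases x; cases y) simp_all
  ultimately show ?thesis
    by (cases s; cases t) simp
qed

lemma number_inject [simp]: "number s = number t \<longleftrightarrow> s = t"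
  using cmp_eq_EQUAL[of s t] by (auto simp: cmp_number compare_nat_def split: if_splits)

definition ascending :: "map4 list \<Rightarrow> bool" where
  "ascending X \<longleftrightarrow> sorted_wrt (<) (map number X)"

text \<open>A strictly increasing list is a canonical name for its set of elements, so sets of maps
  can be compared as lists.\<close>

lemma ascending_unique: "ascending X \<Longrightarrow> ascending Y \<Longrightarrow> set X = set Y \<Longrightarrow> X = Y"
  unfolding ascending_def
  by (metis inj_map_eq_map injI list.set_map number_inject strict_sorted_equal)

lemma ins_Cons: "ins x (y # ys) =
    (if number x < number y then x # y # ys else if x = y then y # ys else y # ins x ys)"
  by (simp add: cmp_number compare_nat_def)

lemma set_ins [simp]: "set (ins x X) = insert x (set X)"
  by (induction X) (auto simp: ins_Cons simp del: ins.simps(2))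

lemma ascending_ins: "ascending X \<Longrightarrow> ascending (ins x X)"
proof (induction X)
  case (Cons y X)
  show ?case
  proof (cases "number x < number y")
    case False
    with Cons have "x = y \<or> number y < number x" "ascending X" "ascending (ins x X)"
      by (auto simp: ascending_def)
    with False Cons.prems show ?thesis
      by (auto simp: ins_Cons ascending_def simp del: ins.simps(2))
  qed (use Cons in \<open>auto simp: ins_Cons ascending_def simp del: ins.simps(2)\<close>)
qed (simp add: ascending_def)

lemma set_srt [simp]: "set (srt X) = set X"
  by (induction X) auto

lemma ascending_srt: "ascending (srt X)"
  by (induction X) (simp_all add: ascending_ins, simp add: ascending_def)

text \<open>A set of maps is stored under its sorted list of values, preceded by a hash value that keeps the
  trie balanced near its root.\<close>

fun xor4 :: "four \<Rightarrow> four \<Rightarrow> four" where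
  "xor4 A0 A0 = A0"
| "xor4 A0 A1 = A1"
| "xor4 A0 A2 = A2"
| "xor4 A0 A3 = A3"
| "xor4 A1 A0 = A1"
| "xor4 A1 A1 = A0"
| "xor4 A1 A2 = A3"
| "xor4 A1 A3 = A2"
| "xor4 A2 A0 = A2"
| "xor4 A2 A1 = A3"
| "xor4 A2 A2 = A0"
| "xor4 A2 A3 = A1"
| "xor4 A3 A0 = A3"
| "xor4 A3 A1 = A2"
| "xor4 A3 A2 = A1"
| "xor4 A3 A3 = A0"

fun xor :: "map4 \<Rightarrow> map4 \<Rightarrow> map4" where
  "xor (M a b c d) (M a' b' c' d') = M (xor4 a a') (xor4 b b') (xor4 c c') (xor4 d d')"

fun hash :: "map4 list \<Rightarrow> map4" where
  "hash [] = M A0 A0 A0 A0"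
| "hash (s # X) = xor s (hash X)"

fun flat :: "map4 list \<Rightarrow> four list" where
  "flat [] = []"
| "flat (M a b c d # X) = a # b # c # d # flat X"

definition key :: "map4 list \<Rightarrow> four list" where
  "key X = flat (hash X # X)"

lemma flat_inject [simp]: "flat X = flat Y \<longleftrightarrow> X = Y"
proof (induction X arbitrary: Y rule: flat.induct)
  case 1
  show ?case by (cases Y rule: flat.cases) auto
next
  case (2 a b c d X)
  then show ?case by (cases Y rule: flat.cases) auto
qed

lemma key_inject [simp]: "key X = key Y \<longleftrightarrow> X = Y"
  by (auto simp: key_def)

section \<open>The family of traces\<close>

text \<open>The 174 maps of the overview, cut into short groups so that the inner recursion of the
  search carries only one group at a time.\<close>

definition univ_groups :: "map4 list list" where
  "univ_groups =
    [[M A0 A0 A0 A3, M A0 A0 A1 A2, M A0 A0 A1 A3, M A0 A0 A2 A0, M A0 A0 A2 A1, M A0 A0 A2 A2,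
      M A0 A0 A2 A3, M A0 A0 A3 A1, M A0 A0 A3 A2, M A0 A1 A0 A0, M A0 A1 A0 A1, M A0 A1 A0 A2,
      M A0 A1 A0 A3, M A0 A1 A1 A0, M A0 A1 A1 A1],
     [M A0 A1 A1 A2, M A0 A1 A1 A3, M A0 A1 A2 A0, M A0 A1 A2 A1, M A0 A1 A2 A2, M A0 A1 A3 A0,
      M A0 A1 A3 A1, M A0 A1 A3 A2, M A0 A1 A3 A3, M A0 A2 A0 A1, M A0 A2 A0 A3, M A0 A2 A1 A0,
      M A0 A2 A1 A1, M A0 A2 A1 A2, M A0 A2 A1 A3],
     [M A0 A2 A2 A1, M A0 A2 A2 A3, M A0 A2 A3 A0, M A0 A2 A3 A1, M A0 A2 A3 A2, M A0 A2 A3 A3,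
      M A0 A3 A0 A1, M A0 A3 A0 A2, M A0 A3 A1 A0, M A0 A3 A1 A1, M A0 A3 A1 A2, M A0 A3 A1 A3,
      M A0 A3 A2 A0, M A0 A3 A2 A1, M A0 A3 A2 A2],
     [M A0 A3 A2 A3, M A0 A3 A3 A1, M A0 A3 A3 A2, M A1 A0 A0 A2, M A1 A0 A0 A3, M A1 A0 A1 A2,
      M A1 A0 A1 A3, M A1 A0 A2 A0, M A1 A0 A2 A1, M A1 A0 A2 A2, M A1 A0 A2 A3, M A1 A0 A3 A0,
      M A1 A0 A3 A1, M A1 A0 A3 A2, M A1 A0 A3 A3],
     [M A1 A1 A0 A2, M A1 A1 A0 A3, M A1 A1 A2 A0, M A1 A1 A2 A3, M A1 A1 A3 A0, M A1 A1 A3 A2,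
      M A1 A2 A0 A0, M A1 A2 A0 A1, M A1 A2 A0 A2, M A1 A2 A0 A3, M A1 A2 A1 A0, M A1 A2 A1 A3,
      M A1 A2 A2 A0, M A1 A2 A2 A3, M A1 A2 A3 A0],
     [M A1 A2 A3 A1, M A1 A2 A3 A2, M A1 A2 A3 A3, M A1 A3 A0 A0, M A1 A3 A0 A1, M A1 A3 A0 A2,
      M A1 A3 A0 A3, M A1 A3 A1 A0, M A1 A3 A1 A2, M A1 A3 A2 A0, M A1 A3 A2 A1, M A1 A3 A2 A2,
      M A1 A3 A2 A3, M A1 A3 A3 A0, M A1 A3 A3 A2],
     [M A2 A0 A0 A1, M A2 A0 A0 A3, M A2 A0 A1 A0, M A2 A0 A1 A1, M A2 A0 A1 A2, M A2 A0 A1 A3,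
      M A2 A0 A2 A1, M A2 A0 A2 A3, M A2 A0 A3 A0, M A2 A0 A3 A1, M A2 A0 A3 A2, M A2 A0 A3 A3,
      M A2 A1 A0 A0, M A2 A1 A0 A1, M A2 A1 A0 A2],
     [M A2 A1 A0 A3, M A2 A1 A1 A0, M A2 A1 A1 A3, M A2 A1 A2 A0, M A2 A1 A2 A3, M A2 A1 A3 A0,
      M A2 A1 A3 A1, M A2 A1 A3 A2, M A2 A1 A3 A3, M A2 A2 A0 A1, M A2 A2 A0 A3, M A2 A2 A1 A0,
      M A2 A2 A1 A3, M A2 A2 A3 A0, M A2 A2 A3 A1],
     [M A2 A3 A0 A0, M A2 A3 A0 A1, M A2 A3 A0 A2, M A2 A3 A0 A3, M A2 A3 A1 A0, M A2 A3 A1 A1,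
      M A2 A3 A1 A2, M A2 A3 A1 A3, M A2 A3 A2 A0, M A2 A3 A2 A1, M A2 A3 A3 A0, M A2 A3 A3 A1,
      M A3 A0 A0 A1, M A3 A0 A0 A2, M A3 A0 A1 A0],
     [M A3 A0 A1 A1, M A3 A0 A1 A2, M A3 A0 A1 A3, M A3 A0 A2 A0, M A3 A0 A2 A1, M A3 A0 A2 A2,
      M A3 A0 A2 A3, M A3 A0 A3 A1, M A3 A0 A3 A2, M A3 A1 A0 A0, M A3 A1 A0 A1, M A3 A1 A0 A2,
      M A3 A1 A0 A3, M A3 A1 A1 A0, M A3 A1 A1 A2],
     [M A3 A1 A2 A0, M A3 A1 A2 A1, M A3 A1 A2 A2, M A3 A1 A2 A3, M A3 A1 A3 A0, M A3 A1 A3 A2,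
      M A3 A2 A0 A0, M A3 A2 A0 A1, M A3 A2 A0 A2, M A3 A2 A0 A3, M A3 A2 A1 A0, M A3 A2 A1 A1,
      M A3 A2 A1 A2, M A3 A2 A1 A3, M A3 A2 A2 A0],
     [M A3 A2 A2 A1, M A3 A2 A3 A0, M A3 A2 A3 A1, M A3 A3 A0 A1, M A3 A3 A0 A2, M A3 A3 A1 A0,
      M A3 A3 A1 A2, M A3 A3 A2 A0, M A3 A3 A2 A1]]"

definition univ :: "map4 list" where
  "univ = concat univ_groups"

text \<open>Both sides are evaluated on all 256 maps.\<close>

lemma set_univ_iff: "s \<in> set univ \<longleftrightarrow> nrm s = s \<and> s \<noteq> idm"
proof -
  define F where "F = [A0, A1, A2, A3]"
  have "list_all (\<lambda>a. list_all (\<lambda>b. list_all (\<lambda>c. list_all (\<lambda>d.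
      mem (M a b c d) (add_all univ E) = (nrm (M a b c d) = M a b c d \<and> M a b c d \<noteq> idm)) F) F) F) F"
    unfolding F_def by code_simp
  moreover have "x \<in> set F" for x
    using four_cases[of x] by (auto simp: F_def)
  ultimately show ?thesis
    by (cases s) (simp add: list_all_iff del: nrm.simps)
qed

lemma nrm_univ: "nrm s = idm \<or> nrm s \<in> set univ"
  by (simp add: set_univ_iff)

definition cent :: "op3 set \<Rightarrow> map4 set" where
  "cent F = {s. \<forall>f\<in>F. com f s}"

text \<open>Recovers a monoid from its trace. The case \<open>idm\<close> restores the identity and
  the constant maps, which are absent from \<open>univ\<close>.\<close>

definition gen :: "map4 list \<Rightarrow> map4 set" where
  "gen X = {s. nrm s = idm \<or> nrm s \<in> set X}"

definition triples :: "(four \<times> four \<times> four) list" where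
  "triples =
    [(A0, A1, A2), (A0, A1, A3), (A0, A2, A1), (A0, A2, A3), (A0, A3, A1), (A0, A3, A2),
     (A1, A0, A2), (A1, A0, A3), (A1, A2, A0), (A1, A2, A3), (A1, A3, A0), (A1, A3, A2),
     (A2, A0, A1), (A2, A0, A3), (A2, A1, A0), (A2, A1, A3), (A2, A3, A0), (A2, A3, A1),
     (A3, A0, A1), (A3, A0, A2), (A3, A1, A0), (A3, A1, A2), (A3, A2, A0), (A3, A2, A1)]"

fun com_on :: "op3 \<Rightarrow> map4 \<Rightarrow> bool \<Rightarrow> (four \<times> four \<times> four) list \<Rightarrow> bool" where
  "com_on f s False ts = False"
| "com_on f s True [] = True"
| "com_on f s True ((x, y, z) # ts) =
    com_on f s (same (ap s (f x y z)) (f (ap s x) (ap s y) (ap s z))) ts"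

fun star :: "op3 \<Rightarrow> map4 list \<Rightarrow> map4 list" where
  "star f [] = []"
| "star f (s # ss) = cons_if (com_on f s True triples) s (star f ss)"

lemma triples_cases: "(x, y, z) \<in> set triples \<or> x = y \<or> x = z \<or> y = z"
  by (cases x; cases y; cases z) (simp_all add: triples_def)

lemma com_on_iff: "com_on f s b ts \<longleftrightarrow>
    b \<and> (\<forall>(x, y, z)\<in>set ts. ap s (f x y z) = f (ap s x) (ap s y) (ap s z))"
  by (induction f s b ts rule: com_on.induct) auto

text \<open>On a triple with a repeated entry both sides are fixed by the majority identities, so
  the 24 triples of distinct points decide.\<close>

lemma com_on_triples:
  assumes "maj f"
  shows "com_on f s True triples \<longleftrightarrow> com f s"
proof
  assume *: "com_on f s True triples"
  show "com f s"
    unfolding com_def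
  proof (intro allI)
    fix x y z
    show "ap s (f x y z) = f (ap s x) (ap s y) (ap s z)"
      using triples_cases[of x y z] * majD[OF assms] by (auto simp: com_on_iff)
  qed
qed (auto simp: com_on_iff com_def)

lemma set_star: "maj f \<Longrightarrow> set (star f X) = {s \<in> set X. com f s}"
  by (induction X) (auto simp: com_on_triples)

text \<open>A majority operation \<open>f\<close> is given by one row for each \<open>x\<close>, which lists the values \<open>f x y z\<close> in the
  order \<open>(1, 2), (1, 3), (2, 1), (2, 3), (3, 1), (3, 2)\<close> of the pairs \<open>(x xor y, x xor z)\<close>.\<close>

datatype row = Row four four four four four four

datatype table = Tab row row row row

fun row_of :: "table \<Rightarrow> four \<Rightarrow> row" where
  "row_of (Tab r0 r1 r2 r3) A0 = r0"
| "row_of (Tab r0 r1 r2 r3) A1 = r1"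
| "row_of (Tab r0 r1 r2 r3) A2 = r2"
| "row_of (Tab r0 r1 r2 r3) A3 = r3"

fun entry :: "row \<Rightarrow> four \<Rightarrow> four \<Rightarrow> four \<Rightarrow> four \<Rightarrow> four" where
  "entry r A0 v x y = x"
| "entry r A1 A0 x y = x"
| "entry r A2 A0 x y = x"
| "entry r A3 A0 x y = x"
| "entry r A1 A1 x y = y"
| "entry r A2 A2 x y = y"
| "entry r A3 A3 x y = y"
| "entry (Row a b c d e f) A1 A2 x y = a"
| "entry (Row a b c d e f) A1 A3 x y = b"
| "entry (Row a b c d e f) A2 A1 x y = c"
| "entry (Row a b c d e f) A2 A3 x y = d"
| "entry (Row a b c d e f) A3 A1 x y = e"
| "entry (Row a b c d e f) A3 A2 x y = f"

definition wit :: "table \<Rightarrow> op3" where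
  "wit w x y z = entry (row_of w x) (xor4 x y) (xor4 x z) x y"

text \<open>On triples with a repeated entry, \<open>entry\<close> returns the majority value
  without consulting the row; hence every table gives a majority operation.\<close>

lemma maj_wit: "maj (wit w)"
  unfolding maj_def
proof (intro allI)
  fix x y
  show "wit w x x y = x \<and> wit w x y x = x \<and> wit w y x x = x"
    by (cases x; cases y) (simp_all add: wit_def)
qed

lemma cent_wit: "cent {wit w} = gen (star (wit w) univ)"
proof (rule set_eqI)
  fix s
  have "com (wit w) s \<longleftrightarrow> com (wit w) (nrm s)"
    by (simp add: com_nrm[OF maj_wit])
  then show "s \<in> cent {wit w} \<longleftrightarrow> s \<in> gen (star (wit w) univ)"
    using nrm_univ[of s] com_idm[of "wit w"] by (auto simp: cent_def gen_def set_star[OF maj_wit])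
qed

section \<open>The symmetric group acting on traces\<close>

definition perms :: "(map4 \<times> map4) list" where
  "perms =
    [(M A0 A1 A2 A3, M A0 A1 A2 A3), (M A0 A1 A3 A2, M A0 A1 A3 A2),
     (M A0 A2 A1 A3, M A0 A2 A1 A3), (M A0 A2 A3 A1, M A0 A3 A1 A2),
     (M A0 A3 A1 A2, M A0 A2 A3 A1), (M A0 A3 A2 A1, M A0 A3 A2 A1),
     (M A1 A0 A2 A3, M A1 A0 A2 A3), (M A1 A0 A3 A2, M A1 A0 A3 A2),
     (M A1 A2 A0 A3, M A2 A0 A1 A3), (M A1 A2 A3 A0, M A3 A0 A1 A2),
     (M A1 A3 A0 A2, M A2 A0 A3 A1), (M A1 A3 A2 A0, M A3 A0 A2 A1),
     (M A2 A0 A1 A3, M A1 A2 A0 A3), (M A2 A0 A3 A1, M A1 A3 A0 A2),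
     (M A2 A1 A0 A3, M A2 A1 A0 A3), (M A2 A1 A3 A0, M A3 A1 A0 A2),
     (M A2 A3 A0 A1, M A2 A3 A0 A1), (M A2 A3 A1 A0, M A3 A2 A0 A1),
     (M A3 A0 A1 A2, M A1 A2 A3 A0), (M A3 A0 A2 A1, M A1 A3 A2 A0),
     (M A3 A1 A0 A2, M A2 A1 A3 A0), (M A3 A1 A2 A0, M A3 A1 A2 A0),
     (M A3 A2 A0 A1, M A2 A3 A1 A0), (M A3 A2 A1 A0, M A3 A2 A1 A0)]"

lemma perms_inverse: "(p, q) \<in> set perms \<Longrightarrow> inverse_pair p q"
  by (auto simp: perms_def inverse_pair_def idm_def)

lemma perms_comp:
  assumes "(p, q) \<in> set perms" "(p', q') \<in> set perms"
  shows "(comp p p', comp q' q) \<in> set perms"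
proof -
  have "list_all (\<lambda>(p, q). list_all (\<lambda>(p', q'). (comp p p', comp q' q) \<in> set perms) perms) perms"
    by code_simp
  then show ?thesis
    using assms by (fastforce simp: list_all_iff)
qed

lemma conjugate_conjugate_univ:
  "inverse_pair p q \<Longrightarrow> s \<in> set univ \<Longrightarrow> conjugate p q (conjugate q p s) = s"
  by (simp add: conjugate_conjugate set_univ_iff)

lemma conjugate_univ: "inverse_pair p q \<Longrightarrow> s \<in> set univ \<Longrightarrow> conjugate p q s \<in> set univ"
  using conjugate_eq_idm by (fastforce simp: set_univ_iff)

lemma inj_on_conjugate: "inverse_pair p q \<Longrightarrow> inj_on (conjugate p q) (set univ)"
  by (rule inj_on_inverseI[where g = "conjugate q p"])
     (simp add: conjugate_conjugate_univ inverse_pair_sym)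

text \<open>A conjugate of the trace of one operation is again the trace of one operation, namely of
  a twist. So one witness per orbit suffices.\<close>

lemma cent_conjugate:
  assumes pq: "inverse_pair p q" and f: "maj f" "cent {f} = gen X" and X: "set X \<subseteq> set univ"
    and Y: "set Y = conjugate p q ` set X"
  shows "cent {twist q p f} = gen Y"
proof (rule set_eqI)
  fix s
  note qp = inverse_pair_sym[OF pq]
  have "s \<in> cent {twist q p f} \<longleftrightarrow> conjugate q p s \<in> cent {f}"
    using com_conjugate[OF qp f(1)] by (simp add: cent_def)
  also have "\<dots> \<longleftrightarrow> conjugate q p s = idm \<or> conjugate q p s \<in> set X"
    by (simp add: f(2) gen_def)
  also have "conjugate q p s = idm \<longleftrightarrow> nrm s = idm"
  proof
    assume "nrm s = idm"
    then have "conjugate q p s = nrm (comp q (comp idm p))"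
      using nrm_comp_nrm[of q p s] qp by (simp add: conjugate_def inverse_pair_def)
    then show "conjugate q p s = idm"
      using qp by (simp add: inverse_pair_def)
  qed (rule conjugate_eq_idm[OF qp])
  also have "conjugate q p s \<in> set X \<longleftrightarrow> nrm s \<in> set Y"
  proof
    assume "conjugate q p s \<in> set X"
    then have "conjugate p q (conjugate q p s) \<in> set Y"
      using Y by blast
    then show "nrm s \<in> set Y"
      by (simp add: conjugate_conjugate[OF pq])
  next
    assume "nrm s \<in> set Y"
    then obtain r where r: "r \<in> set X" "nrm s = conjugate p q r"
      using Y by blast
    have "conjugate q p s = conjugate q p (nrm s)"
      using nrm_comp_nrm[of q p s] qp by (simp add: conjugate_def inverse_pair_def)
    also have "\<dots> = r"
      using r X by (auto simp: conjugate_conjugate_univ[OF qp])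
    finally show "conjugate q p s \<in> set X"
      using r by simp
  qed
  finally show "s \<in> cent {twist q p f} \<longleftrightarrow> s \<in> gen Y"
    by (simp add: gen_def)
qed

text \<open>The list needs no certificate: any table yields a majority operation, the traces are
  computed from it, and only the number of their conjugates and the outcome of the search are
  checked.\<close>

definition tables :: "table list" where
  "tables =
    [Tab (Row A1 A2 A0 A1 A2 A2) (Row A2 A0 A2 A2 A3 A3) (Row A0 A2 A0 A1 A0 A1) (Row A2 A0 A2 A3 A0 A1),
     Tab (Row A3 A2 A1 A1 A1 A1) (Row A1 A1 A2 A1 A3 A1) (Row A0 A3 A0 A3 A2 A3) (Row A2 A0 A3 A2 A0 A2),
     Tab (Row A3 A0 A2 A1 A1 A0) (Row A2 A1 A3 A0 A0 A1) (Row A2 A2 A0 A0 A1 A2) (Row A3 A3 A1 A1 A0 A3),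
     Tab (Row A1 A1 A2 A1 A2 A1) (Row A1 A0 A2 A1 A0 A2) (Row A2 A1 A2 A1 A2 A2) (Row A1 A0 A0 A1 A2 A0),
     Tab (Row A1 A0 A1 A2 A0 A2) (Row A0 A1 A1 A2 A1 A2) (Row A3 A2 A3 A0 A3 A0) (Row A3 A2 A2 A1 A2 A0),
     Tab (Row A1 A1 A1 A3 A0 A0) (Row A1 A0 A0 A0 A0 A3) (Row A0 A1 A0 A0 A0 A0) (Row A3 A3 A2 A0 A2 A1),
     Tab (Row A2 A3 A1 A3 A1 A2) (Row A3 A2 A2 A0 A2 A0) (Row A3 A0 A3 A1 A0 A3) (Row A0 A1 A0 A1 A2 A1),
     Tab (Row A0 A0 A0 A0 A0 A0) (Row A2 A0 A2 A0 A0 A2) (Row A1 A0 A1 A0 A1 A0) (Row A0 A0 A0 A0 A1 A2),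
     Tab (Row A0 A1 A1 A0 A0 A0) (Row A1 A1 A1 A1 A1 A0) (Row A1 A1 A0 A0 A0 A1) (Row A0 A1 A0 A1 A0 A0),
     Tab (Row A0 A1 A1 A2 A0 A2) (Row A1 A0 A0 A3 A1 A3) (Row A2 A3 A3 A1 A2 A0) (Row A3 A2 A2 A0 A3 A1),
     Tab (Row A1 A1 A1 A2 A0 A3) (Row A0 A1 A1 A2 A1 A3) (Row A3 A3 A3 A0 A2 A1) (Row A2 A3 A3 A0 A3 A1),
     Tab (Row A0 A1 A0 A1 A1 A1) (Row A1 A0 A0 A0 A1 A0) (Row A2 A2 A0 A0 A0 A1) (Row A2 A2 A0 A1 A0 A1),
     Tab (Row A1 A0 A0 A0 A1 A2) (Row A0 A1 A1 A2 A1 A1) (Row A2 A2 A1 A0 A1 A0) (Row A0 A0 A0 A0 A1 A0),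
     Tab (Row A0 A0 A1 A0 A1 A0) (Row A0 A1 A1 A1 A0 A1) (Row A0 A0 A2 A0 A2 A0) (Row A1 A0 A0 A1 A0 A1),
     Tab (Row A0 A0 A0 A0 A0 A2) (Row A0 A0 A0 A2 A0 A0) (Row A0 A0 A0 A0 A0 A0) (Row A3 A3 A0 A0 A0 A0),
     Tab (Row A1 A0 A0 A0 A1 A0) (Row A1 A1 A0 A0 A0 A1) (Row A3 A3 A3 A0 A3 A0) (Row A2 A2 A2 A0 A2 A0),
     Tab (Row A0 A0 A1 A2 A1 A3) (Row A3 A2 A0 A3 A0 A2) (Row A2 A2 A3 A1 A3 A0) (Row A2 A3 A3 A0 A3 A1),
     Tab (Row A0 A0 A0 A2 A0 A2) (Row A1 A1 A2 A2 A2 A2) (Row A3 A2 A3 A2 A2 A1) (Row A3 A2 A2 A1 A2 A3),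
     Tab (Row A2 A3 A1 A1 A1 A1) (Row A3 A2 A0 A0 A0 A0) (Row A3 A3 A0 A0 A1 A1) (Row A2 A2 A1 A1 A0 A0),
     Tab (Row A0 A2 A3 A1 A2 A2) (Row A3 A3 A2 A0 A3 A1) (Row A2 A0 A1 A3 A0 A0) (Row A1 A1 A0 A2 A1 A3),
     Tab (Row A2 A3 A1 A2 A1 A0) (Row A3 A2 A0 A3 A0 A1) (Row A0 A1 A3 A0 A3 A2) (Row A1 A0 A2 A1 A2 A3),
     Tab (Row A1 A2 A1 A2 A1 A1) (Row A0 A2 A2 A2 A2 A0) (Row A0 A0 A1 A0 A1 A0) (Row A2 A1 A0 A1 A0 A2),
     Tab (Row A1 A1 A0 A0 A0 A0) (Row A0 A0 A1 A0 A1 A0) (Row A1 A0 A1 A1 A0 A1) (Row A0 A1 A0 A1 A1 A1),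
     Tab (Row A0 A1 A1 A1 A0 A1) (Row A0 A1 A1 A0 A0 A0) (Row A1 A0 A1 A1 A0 A0) (Row A1 A0 A0 A1 A1 A0),
     Tab (Row A0 A0 A0 A1 A0 A0) (Row A1 A1 A1 A0 A1 A1) (Row A1 A1 A0 A1 A1 A1) (Row A0 A0 A1 A0 A0 A0),
     Tab (Row A0 A0 A1 A0 A1 A2) (Row A0 A0 A1 A2 A1 A0) (Row A2 A2 A0 A0 A0 A0) (Row A0 A1 A0 A0 A1 A0),
     Tab (Row A1 A1 A1 A2 A1 A2) (Row A1 A0 A0 A2 A0 A2) (Row A0 A0 A0 A0 A0 A0) (Row A0 A0 A1 A1 A0 A0),
     Tab (Row A0 A0 A0 A0 A1 A2) (Row A1 A1 A0 A2 A1 A0) (Row A0 A1 A2 A1 A2 A0) (Row A1 A0 A0 A0 A0 A0),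
     Tab (Row A1 A1 A1 A0 A1 A0) (Row A1 A1 A1 A0 A1 A0) (Row A3 A3 A0 A0 A1 A1) (Row A2 A2 A1 A1 A0 A0),
     Tab (Row A0 A1 A0 A0 A0 A0) (Row A0 A0 A0 A0 A0 A0) (Row A2 A2 A0 A0 A1 A0) (Row A0 A0 A1 A1 A0 A0),
     Tab (Row A2 A3 A0 A3 A0 A2) (Row A0 A0 A1 A2 A1 A3) (Row A2 A3 A3 A1 A2 A1) (Row A2 A3 A3 A1 A2 A1),
     Tab (Row A1 A1 A1 A3 A1 A3) (Row A1 A1 A0 A3 A0 A3) (Row A2 A2 A3 A1 A3 A0) (Row A3 A2 A3 A0 A3 A1),
     Tab (Row A2 A3 A0 A2 A0 A2) (Row A3 A2 A3 A2 A2 A2) (Row A3 A2 A2 A2 A3 A0) (Row A3 A3 A3 A0 A3 A3),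
     Tab (Row A1 A1 A2 A2 A2 A2) (Row A1 A1 A0 A2 A0 A2) (Row A2 A2 A2 A2 A2 A0) (Row A2 A2 A2 A0 A2 A2),
     Tab (Row A1 A1 A2 A3 A3 A3) (Row A3 A2 A1 A3 A1 A3) (Row A2 A2 A3 A1 A2 A2) (Row A3 A3 A3 A2 A2 A1),
     Tab (Row A2 A3 A1 A3 A1 A2) (Row A2 A1 A3 A2 A2 A2) (Row A3 A2 A1 A2 A1 A1) (Row A2 A2 A1 A2 A3 A3),
     Tab (Row A1 A3 A1 A3 A3 A3) (Row A1 A1 A3 A1 A2 A1) (Row A3 A1 A1 A2 A1 A1) (Row A2 A2 A2 A1 A3 A3),
     Tab (Row A1 A1 A1 A2 A1 A2) (Row A0 A0 A1 A2 A0 A2) (Row A1 A0 A0 A1 A0 A0) (Row A1 A0 A2 A0 A2 A1),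
     Tab (Row A0 A0 A1 A1 A0 A0) (Row A1 A1 A0 A1 A1 A0) (Row A1 A0 A2 A0 A2 A1) (Row A2 A2 A1 A1 A0 A0),
     Tab (Row A1 A0 A1 A2 A0 A0) (Row A1 A0 A0 A0 A1 A2) (Row A0 A0 A0 A0 A1 A0) (Row A2 A2 A2 A0 A2 A0),
     Tab (Row A0 A3 A2 A2 A1 A0) (Row A1 A0 A1 A1 A1 A3) (Row A1 A3 A2 A2 A3 A1) (Row A3 A3 A3 A3 A0 A1),
     Tab (Row A0 A1 A0 A3 A1 A3) (Row A1 A0 A1 A2 A0 A2) (Row A3 A2 A3 A0 A2 A0) (Row A2 A3 A2 A1 A3 A1),
     Tab (Row A1 A0 A1 A3 A1 A3) (Row A0 A1 A0 A2 A0 A2) (Row A3 A2 A3 A1 A3 A1) (Row A2 A3 A2 A0 A2 A0),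
     Tab (Row A0 A0 A0 A1 A0 A0) (Row A0 A0 A1 A1 A0 A0) (Row A0 A0 A1 A0 A0 A0) (Row A1 A0 A0 A1 A0 A0),
     Tab (Row A1 A1 A0 A2 A0 A0) (Row A0 A0 A1 A0 A1 A2) (Row A2 A2 A0 A1 A0 A1) (Row A2 A2 A2 A1 A2 A1),
     Tab (Row A0 A1 A1 A0 A0 A0) (Row A0 A0 A1 A1 A1 A0) (Row A0 A0 A0 A0 A0 A1) (Row A0 A0 A0 A0 A0 A1),
     Tab (Row A0 A0 A0 A3 A0 A2) (Row A0 A0 A0 A2 A0 A3) (Row A0 A0 A2 A0 A2 A0) (Row A0 A0 A3 A0 A3 A0),
     Tab (Row A1 A1 A0 A2 A0 A3) (Row A0 A0 A0 A3 A0 A2) (Row A3 A2 A2 A0 A3 A0) (Row A3 A2 A2 A0 A3 A0),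
     Tab (Row A2 A3 A2 A2 A3 A3) (Row A3 A2 A0 A3 A0 A2) (Row A2 A3 A2 A0 A2 A2) (Row A2 A3 A3 A3 A3 A0),
     Tab (Row A1 A1 A2 A2 A3 A3) (Row A1 A1 A1 A1 A1 A1) (Row A2 A1 A2 A2 A1 A2) (Row A1 A3 A1 A3 A1 A1),
     Tab (Row A2 A3 A1 A3 A1 A2) (Row A2 A1 A3 A1 A2 A2) (Row A3 A2 A1 A2 A1 A1) (Row A2 A2 A1 A1 A3 A3),
     Tab (Row A1 A1 A1 A2 A1 A2) (Row A3 A2 A1 A1 A1 A1) (Row A2 A1 A3 A1 A2 A2) (Row A2 A3 A1 A3 A2 A1),
     Tab (Row A0 A0 A0 A2 A0 A2) (Row A0 A0 A1 A2 A1 A2) (Row A2 A3 A3 A0 A2 A2) (Row A3 A3 A3 A3 A3 A0),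
     Tab (Row A2 A3 A2 A3 A3 A3) (Row A3 A2 A3 A2 A2 A2) (Row A3 A2 A3 A2 A1 A1) (Row A2 A3 A1 A3 A0 A0),
     Tab (Row A0 A0 A2 A2 A3 A3) (Row A1 A1 A3 A3 A2 A3) (Row A2 A3 A2 A0 A3 A1) (Row A2 A2 A3 A1 A3 A0),
     Tab (Row A1 A0 A0 A2 A0 A1) (Row A1 A0 A1 A0 A1 A2) (Row A2 A2 A1 A0 A0 A1) (Row A2 A2 A0 A1 A1 A0),
     Tab (Row A1 A0 A1 A0 A1 A2) (Row A0 A1 A0 A2 A0 A0) (Row A0 A1 A0 A1 A0 A0) (Row A0 A0 A2 A0 A2 A1),
     Tab (Row A0 A0 A0 A0 A1 A0) (Row A1 A1 A1 A1 A0 A1) (Row A0 A1 A2 A0 A2 A0) (Row A1 A0 A0 A1 A0 A1),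
     Tab (Row A1 A1 A0 A0 A0 A0) (Row A1 A1 A1 A1 A1 A0) (Row A2 A2 A0 A1 A0 A0) (Row A1 A0 A2 A0 A2 A1),
     Tab (Row A0 A0 A0 A0 A1 A0) (Row A1 A1 A0 A1 A1 A1) (Row A2 A2 A2 A0 A2 A0) (Row A1 A0 A1 A1 A0 A1),
     Tab (Row A1 A1 A0 A0 A1 A1) (Row A1 A1 A1 A1 A2 A1) (Row A2 A1 A0 A0 A1 A2) (Row A1 A2 A1 A1 A1 A1),
     Tab (Row A1 A1 A2 A2 A3 A3) (Row A1 A1 A3 A0 A2 A0) (Row A3 A0 A2 A2 A0 A1) (Row A0 A2 A0 A1 A3 A3),
     Tab (Row A0 A0 A0 A0 A0 A0) (Row A1 A1 A1 A1 A1 A1) (Row A1 A0 A0 A0 A1 A1) (Row A0 A1 A1 A1 A0 A0),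
     Tab (Row A0 A0 A1 A0 A1 A0) (Row A0 A0 A1 A0 A1 A0) (Row A0 A0 A0 A0 A0 A0) (Row A0 A0 A0 A0 A0 A0),
     Tab (Row A0 A0 A0 A3 A0 A2) (Row A3 A2 A3 A2 A2 A3) (Row A3 A3 A3 A1 A3 A1) (Row A2 A2 A2 A1 A2 A1),
     Tab (Row A2 A3 A1 A2 A1 A3) (Row A3 A2 A1 A3 A1 A2) (Row A2 A3 A2 A1 A2 A2) (Row A2 A3 A2 A3 A3 A1),
     Tab (Row A2 A3 A1 A1 A1 A2) (Row A1 A1 A1 A1 A1 A1) (Row A2 A1 A2 A2 A1 A2) (Row A1 A3 A1 A3 A3 A3),
     Tab (Row A0 A0 A2 A2 A3 A3) (Row A1 A1 A3 A3 A2 A2) (Row A3 A2 A2 A2 A2 A2) (Row A3 A2 A3 A3 A3 A3),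
     Tab (Row A2 A3 A0 A2 A0 A3) (Row A3 A2 A1 A3 A1 A2) (Row A3 A3 A2 A2 A2 A2) (Row A3 A3 A2 A3 A2 A3),
     Tab (Row A0 A0 A2 A2 A3 A2) (Row A1 A1 A3 A3 A2 A3) (Row A3 A2 A2 A0 A3 A1) (Row A2 A3 A3 A1 A2 A0),
     Tab (Row A1 A1 A1 A3 A1 A2) (Row A0 A0 A0 A2 A0 A2) (Row A2 A3 A2 A0 A2 A1) (Row A3 A3 A2 A1 A2 A0),
     Tab (Row A0 A0 A1 A0 A1 A2) (Row A1 A1 A0 A2 A0 A0) (Row A1 A0 A2 A1 A2 A0) (Row A0 A1 A2 A0 A2 A1),
     Tab (Row A0 A0 A0 A0 A0 A0) (Row A1 A1 A1 A1 A1 A1) (Row A2 A2 A2 A1 A2 A1) (Row A2 A2 A2 A1 A2 A1),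
     Tab (Row A1 A1 A1 A2 A1 A2) (Row A1 A1 A1 A2 A1 A2) (Row A3 A3 A2 A1 A2 A0) (Row A3 A3 A3 A0 A3 A1),
     Tab (Row A1 A1 A1 A2 A0 A0) (Row A0 A0 A0 A1 A1 A2) (Row A0 A1 A0 A1 A1 A0) (Row A1 A0 A2 A0 A2 A1),
     Tab (Row A2 A3 A1 A3 A1 A3) (Row A2 A2 A3 A2 A2 A3) (Row A2 A3 A3 A1 A3 A1) (Row A2 A2 A2 A1 A3 A1),
     Tab (Row A1 A0 A2 A0 A0 A0) (Row A0 A2 A3 A1 A1 A1) (Row A3 A1 A0 A2 A2 A2) (Row A2 A0 A1 A0 A3 A3),
     Tab (Row A2 A0 A1 A0 A2 A1) (Row A1 A2 A2 A0 A0 A1) (Row A1 A0 A2 A1 A2 A0) (Row A1 A0 A2 A0 A2 A1),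
     Tab (Row A0 A0 A0 A0 A0 A1) (Row A0 A0 A0 A0 A0 A0) (Row A0 A0 A0 A0 A0 A0) (Row A0 A0 A1 A0 A1 A0),
     Tab (Row A0 A1 A0 A0 A1 A0) (Row A1 A0 A1 A0 A0 A1) (Row A0 A1 A0 A0 A0 A0) (Row A0 A0 A0 A0 A0 A0),
     Tab (Row A0 A0 A2 A0 A3 A0) (Row A3 A2 A0 A2 A0 A3) (Row A0 A3 A0 A0 A0 A0) (Row A2 A0 A0 A0 A0 A0),
     Tab (Row A0 A0 A0 A3 A0 A3) (Row A0 A0 A0 A2 A0 A2) (Row A2 A2 A2 A0 A2 A0) (Row A2 A2 A3 A0 A3 A0),
     Tab (Row A2 A3 A1 A2 A1 A3) (Row A1 A1 A1 A2 A1 A3) (Row A3 A3 A3 A2 A2 A2) (Row A2 A2 A3 A3 A2 A3),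
     Tab (Row A1 A1 A0 A2 A0 A3) (Row A0 A0 A1 A2 A1 A3) (Row A2 A3 A2 A0 A2 A1) (Row A2 A3 A3 A1 A3 A0),
     Tab (Row A0 A0 A0 A2 A0 A3) (Row A1 A1 A1 A3 A1 A2) (Row A3 A3 A3 A0 A2 A1) (Row A2 A2 A2 A1 A3 A0),
     Tab (Row A2 A3 A2 A2 A3 A3) (Row A3 A2 A3 A2 A2 A2) (Row A3 A3 A3 A2 A2 A2) (Row A2 A2 A3 A3 A3 A3),
     Tab (Row A0 A0 A1 A1 A1 A2) (Row A1 A1 A0 A2 A0 A0) (Row A1 A0 A2 A1 A2 A0) (Row A0 A1 A2 A0 A2 A1),
     Tab (Row A1 A0 A1 A1 A0 A0) (Row A0 A1 A0 A0 A1 A1) (Row A0 A0 A1 A1 A1 A1) (Row A0 A1 A0 A0 A0 A0),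
     Tab (Row A1 A0 A1 A0 A1 A0) (Row A1 A1 A1 A0 A1 A0) (Row A0 A0 A0 A1 A0 A1) (Row A0 A0 A1 A1 A0 A1),
     Tab (Row A1 A1 A2 A2 A3 A3) (Row A0 A0 A2 A3 A2 A3) (Row A3 A3 A3 A0 A3 A1) (Row A2 A3 A2 A1 A3 A0),
     Tab (Row A2 A1 A1 A2 A1 A2) (Row A3 A2 A3 A1 A2 A1) (Row A3 A1 A3 A1 A2 A2) (Row A1 A0 A1 A0 A0 A0),
     Tab (Row A0 A2 A2 A2 A2 A0) (Row A1 A3 A3 A3 A3 A1) (Row A2 A0 A0 A0 A0 A2) (Row A3 A1 A1 A1 A1 A3),
     Tab (Row A0 A0 A0 A1 A0 A1) (Row A0 A0 A0 A1 A0 A1) (Row A0 A0 A0 A0 A1 A0) (Row A0 A0 A1 A0 A0 A0),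
     Tab (Row A0 A0 A0 A0 A0 A0) (Row A0 A0 A0 A0 A0 A0) (Row A0 A0 A0 A0 A0 A0) (Row A1 A0 A0 A0 A0 A1),
     Tab (Row A1 A1 A1 A2 A1 A2) (Row A1 A1 A3 A2 A2 A2) (Row A3 A2 A2 A2 A2 A1) (Row A2 A2 A2 A1 A3 A3),
     Tab (Row A0 A0 A0 A2 A0 A3) (Row A0 A0 A0 A3 A0 A2) (Row A2 A2 A2 A0 A3 A0) (Row A3 A3 A2 A0 A3 A0),
     Tab (Row A1 A1 A2 A2 A3 A3) (Row A3 A2 A1 A3 A1 A2) (Row A2 A2 A3 A1 A2 A2) (Row A2 A3 A3 A3 A2 A1),
     Tab (Row A1 A1 A2 A2 A3 A3) (Row A0 A0 A3 A3 A2 A2) (Row A2 A2 A3 A2 A3 A2) (Row A3 A3 A2 A3 A2 A3),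
     Tab (Row A2 A3 A2 A3 A3 A2) (Row A3 A2 A3 A2 A2 A3) (Row A2 A2 A2 A2 A3 A2) (Row A3 A3 A2 A3 A3 A3),
     Tab (Row A2 A3 A2 A2 A3 A3) (Row A3 A2 A3 A3 A2 A2) (Row A2 A2 A3 A2 A3 A2) (Row A3 A3 A3 A3 A3 A3),
     Tab (Row A2 A3 A2 A3 A3 A2) (Row A3 A2 A3 A2 A2 A3) (Row A3 A2 A2 A2 A3 A2) (Row A2 A3 A3 A3 A2 A3),
     Tab (Row A1 A0 A1 A1 A0 A0) (Row A0 A1 A0 A0 A1 A1) (Row A1 A1 A0 A1 A1 A1) (Row A0 A0 A1 A0 A0 A0),
     Tab (Row A2 A3 A1 A2 A1 A2) (Row A1 A1 A1 A2 A1 A3) (Row A3 A2 A3 A2 A2 A2) (Row A3 A2 A3 A3 A2 A3),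
     Tab (Row A2 A3 A1 A3 A1 A2) (Row A1 A1 A1 A2 A1 A3) (Row A2 A2 A2 A2 A2 A2) (Row A3 A3 A3 A2 A3 A3),
     Tab (Row A0 A0 A0 A3 A0 A3) (Row A1 A1 A1 A3 A1 A3) (Row A2 A2 A3 A2 A3 A2) (Row A3 A3 A3 A2 A3 A2),
     Tab (Row A0 A1 A0 A3 A1 A2) (Row A0 A1 A1 A2 A1 A3) (Row A2 A2 A2 A1 A2 A0) (Row A3 A3 A3 A0 A3 A1),
     Tab (Row A1 A0 A2 A0 A1 A2) (Row A3 A2 A1 A1 A2 A2) (Row A2 A2 A3 A1 A1 A1) (Row A2 A0 A1 A0 A3 A3),
     Tab (Row A0 A0 A0 A0 A0 A0) (Row A0 A0 A0 A0 A0 A1) (Row A0 A1 A0 A0 A0 A0) (Row A1 A0 A1 A0 A0 A0),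
     Tab (Row A2 A3 A1 A3 A1 A2) (Row A1 A1 A3 A2 A2 A3) (Row A3 A3 A2 A2 A3 A1) (Row A2 A2 A2 A1 A3 A3),
     Tab (Row A0 A1 A0 A0 A1 A0) (Row A0 A0 A0 A0 A0 A0) (Row A0 A1 A0 A0 A1 A0) (Row A1 A0 A0 A0 A0 A1),
     Tab (Row A1 A0 A1 A0 A0 A0) (Row A0 A1 A0 A1 A1 A0) (Row A0 A0 A0 A1 A1 A1) (Row A0 A0 A0 A0 A0 A0),
     Tab (Row A0 A0 A0 A2 A0 A2) (Row A0 A0 A0 A2 A0 A2) (Row A3 A3 A3 A0 A3 A0) (Row A3 A3 A3 A0 A3 A0),
     Tab (Row A0 A0 A1 A3 A1 A2) (Row A1 A1 A0 A2 A0 A3) (Row A3 A3 A2 A0 A2 A1) (Row A3 A3 A3 A1 A3 A0),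
     Tab (Row A1 A1 A1 A0 A1 A0) (Row A1 A1 A1 A0 A1 A0) (Row A0 A0 A0 A1 A1 A1) (Row A0 A0 A0 A1 A0 A1),
     Tab (Row A0 A0 A0 A0 A0 A0) (Row A1 A0 A0 A1 A0 A1) (Row A0 A1 A0 A0 A1 A0) (Row A1 A0 A1 A1 A0 A1),
     Tab (Row A1 A0 A1 A0 A0 A0) (Row A0 A1 A0 A1 A1 A2) (Row A0 A1 A0 A1 A2 A1) (Row A1 A0 A1 A0 A0 A0),
     Tab (Row A2 A3 A1 A2 A1 A3) (Row A3 A2 A1 A2 A1 A3) (Row A2 A2 A3 A1 A3 A2) (Row A3 A3 A2 A3 A2 A1),
     Tab (Row A0 A3 A0 A0 A3 A0) (Row A3 A0 A3 A1 A0 A1) (Row A0 A1 A0 A0 A1 A0) (Row A1 A0 A1 A1 A0 A1),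
     Tab (Row A1 A1 A2 A2 A2 A2) (Row A0 A0 A2 A2 A2 A2) (Row A2 A2 A2 A0 A2 A1) (Row A2 A2 A2 A1 A2 A0),
     Tab (Row A1 A0 A0 A3 A1 A2) (Row A1 A0 A0 A2 A1 A3) (Row A3 A3 A2 A1 A2 A0) (Row A2 A2 A3 A1 A3 A0),
     Tab (Row A0 A1 A0 A2 A1 A2) (Row A1 A0 A1 A3 A0 A3) (Row A2 A3 A2 A0 A3 A0) (Row A3 A2 A3 A1 A2 A1),
     Tab (Row A0 A0 A0 A0 A0 A0) (Row A0 A0 A0 A1 A0 A1) (Row A0 A0 A0 A0 A1 A0) (Row A0 A0 A1 A0 A0 A0),
     Tab (Row A2 A3 A2 A2 A3 A3) (Row A3 A2 A3 A3 A2 A2) (Row A2 A2 A3 A2 A3 A2) (Row A3 A3 A2 A3 A2 A3),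
     Tab (Row A1 A1 A1 A0 A1 A0) (Row A1 A1 A1 A1 A1 A1) (Row A0 A0 A0 A1 A1 A1) (Row A0 A0 A1 A1 A0 A1),
     Tab (Row A1 A1 A2 A2 A3 A3) (Row A1 A1 A3 A3 A2 A2) (Row A3 A3 A2 A2 A2 A1) (Row A2 A2 A3 A1 A3 A3),
     Tab (Row A2 A0 A2 A0 A0 A0) (Row A0 A2 A0 A1 A2 A1) (Row A0 A1 A0 A2 A1 A2) (Row A1 A0 A1 A0 A0 A0),
     Tab (Row A0 A1 A2 A2 A1 A0) (Row A1 A0 A3 A3 A0 A1) (Row A0 A1 A0 A0 A1 A0) (Row A1 A0 A1 A1 A0 A1),
     Tab (Row A3 A0 A0 A1 A2 A0) (Row A2 A1 A1 A0 A3 A1) (Row A1 A2 A2 A3 A0 A2) (Row A0 A3 A3 A2 A1 A3),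
     Tab (Row A0 A0 A0 A0 A0 A0) (Row A0 A0 A0 A1 A0 A1) (Row A0 A1 A0 A0 A1 A0) (Row A1 A0 A1 A0 A0 A0),
     Tab (Row A0 A0 A0 A3 A0 A2) (Row A0 A0 A0 A2 A0 A3) (Row A2 A2 A2 A0 A2 A0) (Row A3 A3 A3 A0 A3 A0),
     Tab (Row A1 A1 A1 A2 A1 A3) (Row A0 A0 A0 A3 A0 A2) (Row A3 A3 A2 A1 A2 A0) (Row A2 A2 A3 A0 A3 A1),
     Tab (Row A0 A0 A0 A3 A0 A3) (Row A1 A1 A1 A3 A1 A2) (Row A2 A2 A3 A2 A3 A2) (Row A3 A3 A2 A3 A3 A3),
     Tab (Row A0 A0 A0 A3 A0 A2) (Row A1 A1 A1 A3 A1 A2) (Row A3 A2 A3 A2 A3 A2) (Row A3 A2 A2 A3 A2 A3),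
     Tab (Row A2 A3 A1 A3 A1 A2) (Row A3 A2 A0 A2 A0 A3) (Row A3 A3 A3 A1 A3 A0) (Row A2 A2 A3 A0 A3 A1),
     Tab (Row A0 A0 A0 A3 A0 A2) (Row A1 A1 A1 A2 A1 A3) (Row A2 A3 A2 A2 A3 A2) (Row A3 A2 A3 A3 A2 A3),
     Tab (Row A1 A1 A2 A2 A3 A3) (Row A3 A2 A1 A3 A1 A3) (Row A2 A3 A3 A1 A3 A2) (Row A3 A3 A3 A3 A2 A1),
     Tab (Row A2 A3 A1 A3 A1 A2) (Row A3 A2 A0 A2 A0 A3) (Row A2 A2 A3 A1 A3 A0) (Row A3 A3 A2 A0 A2 A1),
     Tab (Row A3 A2 A3 A1 A2 A1) (Row A2 A3 A2 A0 A3 A0) (Row A1 A0 A1 A3 A0 A3) (Row A0 A1 A0 A2 A1 A2),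
     Tab (Row A1 A3 A2 A3 A3 A3) (Row A0 A2 A3 A2 A2 A2) (Row A3 A1 A0 A1 A1 A1) (Row A2 A0 A1 A0 A0 A0),
     Tab (Row A0 A0 A0 A0 A0 A0) (Row A0 A0 A0 A0 A0 A0) (Row A0 A0 A0 A0 A0 A0) (Row A0 A0 A0 A0 A0 A0),
     Tab (Row A2 A3 A2 A2 A3 A2) (Row A3 A2 A3 A3 A2 A3) (Row A2 A3 A2 A2 A3 A2) (Row A3 A2 A3 A3 A2 A3)]"

fun stars :: "table list \<Rightarrow> map4 list list" where
  "stars [] = []"
| "stars (w # ws) = star (wit w) univ # stars ws"

lemma set_stars: "set (stars ws) = (\<lambda>w. star (wit w) univ) ` set ws"
  by (induction ws) auto

definition family :: "map4 list set" where
  "family = {srt (map (conjugate p q) R) | p q R. (p, q) \<in> set perms \<and> R \<in> set (stars tables)}"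

text \<open>The operation is a twist of one of the explicit witnesses.\<close>

lemma family_cent:
  assumes "Y \<in> family"
  obtains f where "maj f" "cent {f} = gen Y" "set Y \<subseteq> set univ" "ascending Y"
proof -
  obtain p q R where pq: "(p, q) \<in> set perms" and R: "R \<in> set (stars tables)"
    and "Y = srt (map (conjugate p q) R)"
    using assms unfolding family_def by blast
  then obtain w where Y: "Y = srt (map (conjugate p q) (star (wit w) univ))"
    by (auto simp: set_stars)
  note pq = perms_inverse[OF pq]
  have X: "set (star (wit w) univ) \<subseteq> set univ"
    by (auto simp: set_star[OF maj_wit])
  have "cent {twist q p (wit w)} = gen Y"
    by (rule cent_conjugate[OF pq maj_wit cent_wit X]) (simp add: Y)
  moreover have "set Y \<subseteq> set univ"
    using X conjugate_univ[OF pq] by (auto simp: Y)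
  ultimately show thesis
    using that maj_twist[OF inverse_pair_sym[OF pq] maj_wit] ascending_srt Y by blast
qed

text \<open>Intersecting a monoid with \<open>univ\<close> gives back its trace, and sorted traces
  are unique. Counting \<open>family\<close> therefore counts monoids.\<close>

lemma gen_inject:
  assumes "X \<in> family" "Y \<in> family" "gen X = gen Y"
  shows "X = Y"
proof -
  have set: "set Z = gen Z \<inter> set univ" if "Z \<in> family" for Z
  proof -
    have "set Z \<subseteq> set univ"
      using family_cent[OF that] by metis
    then show ?thesis
      unfolding gen_def subset_iff set_univ_iff by (auto simp: set_univ_iff)
  qed
  obtain "ascending X" "ascending Y"
    using family_cent[OF assms(1)] family_cent[OF assms(2)] by metis
  moreover have "set X = set Y"
    unfolding set[OF assms(1)] set[OF assms(2)] assms(3) ..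
  ultimately show ?thesis
    by (rule ascending_unique)
qed

lemma family_univ: "Y \<in> family \<Longrightarrow> set Y \<subseteq> set univ"
  using family_cent by metis

lemma family_conjugate:
  assumes "(p, q) \<in> set perms" "Y \<in> family"
  shows "srt (map (conjugate p q) Y) \<in> family"
proof -
  obtain p' q' R where *: "(p', q') \<in> set perms" "R \<in> set (stars tables)"
    "Y = srt (map (conjugate p' q') R)"
    using assms(2) unfolding family_def by blast
  have "set (srt (map (conjugate p q) Y)) = set (srt (map (conjugate (comp p p') (comp q' q)) R))"
    using conjugate_comp[OF perms_inverse[OF assms(1)]] by (simp add: * image_image)
  then have "srt (map (conjugate p q) Y) = srt (map (conjugate (comp p p') (comp q' q)) R)"
    by (intro ascending_unique ascending_srt)
  then show ?thesis
    using perms_comp[OF assms(1) *(1)] *(2) unfolding family_def by blast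
qed

fun conjugates :: "map4 list \<Rightarrow> (map4 \<times> map4) list \<Rightarrow> unit trie" where
  "conjugates R [] = E"
| "conjugates R ((p, q) # ps) = upd (key (srt (map (conjugate p q) R))) () (conjugates R ps)"

fun closed_sets :: "map4 list list \<Rightarrow> unit trie" where
  "closed_sets [] = E"
| "closed_sets (R # Rs) = merge (conjugates R perms) (closed_sets Rs)"

lemma keys_conjugates: "keys (conjugates R ps) = (\<lambda>(p, q). key (srt (map (conjugate p q) R))) ` set ps"
  by (induction R ps rule: conjugates.induct) auto

lemma keys_closed_sets: "keys (closed_sets (stars tables)) = key ` family"
proof -
  have "keys (closed_sets Rs) = (\<Union>R\<in>set Rs. keys (conjugates R perms))" for Rs
    by (induction Rs) auto
  then show ?thesis
    unfolding family_def keys_conjugates by fastforce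
qed

lemma lookup_closed_sets: "lookup (key Y) (closed_sets (stars tables)) \<noteq> [] \<longleftrightarrow> Y \<in> family"
proof -
  have "key Y \<in> keys (closed_sets (stars tables)) \<longleftrightarrow> Y \<in> family"
    unfolding keys_closed_sets by (auto simp: image_iff)
  then show ?thesis
    by (simp add: keys_def)
qed

lemma count_closed_sets: "count_keys (closed_sets (stars tables)) 0 = 1714"
  by code_simp

lemma card_family: "finite family" "card family = 1714"
proof -
  have inj: "inj_on key family"
    by (simp add: inj_on_def)
  have "finite (key ` family)" "card (key ` family) = 1714"
    using count_keys[of "closed_sets (stars tables)" 0] count_closed_sets
    by (simp_all add: keys_closed_sets)
  then show "finite family" "card family = 1714"
    using inj by (auto simp: card_image dest: finite_imageD)
qed

section \<open>The search for extensions\<close>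

text \<open>A rule is stored under every pair of cyclically adjacent premises, so that it is found whenever
  one of its premises is visited last.\<close>

fun add_rotations :: "map4 list \<Rightarrow> map4 \<Rightarrow> rule \<Rightarrow> rule trie \<Rightarrow> rule trie" where
  "add_rotations [] z r t = t"
| "add_rotations [x] z r t = upd (flat [x, z]) r t"
| "add_rotations (x # y # xs) z r t = upd (flat [x, y]) r (add_rotations (y # xs) z r t)"

fun add_rule :: "rule \<Rightarrow> rule trie \<Rightarrow> rule trie" where
  "add_rule ([], r) t = t"
| "add_rule (x # xs, r) t = add_rotations (x # xs) x (x # xs, r) t"

fun conjugate_rules :: "map4 \<Rightarrow> map4 \<Rightarrow> rule list \<Rightarrow> rule trie" where
  "conjugate_rules p q [] = E"
| "conjugate_rules p q (r # rs) = add_rule (conjugate_rule p q r) (conjugate_rules p q rs)"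

fun rule_table :: "(map4 \<times> map4) list \<Rightarrow> rule trie" where
  "rule_table [] = E"
| "rule_table ((p, q) # ps) = merge (conjugate_rules p q rules) (rule_table ps)"

text \<open>An agenda consists of the maps derived so far and those among them that have not been combined
  with the others yet. It becomes \<open>Exit\<close> when a contradiction or a map in \<open>D\<close> is derived; \<open>D\<close> holds
  the maps treated before.\<close>

datatype agenda = Exit | Agenda "unit trie" "map4 list"

fun offer_one :: "bool \<Rightarrow> bool \<Rightarrow> map4 \<Rightarrow> map4 list \<Rightarrow> unit trie \<Rightarrow> agenda" where
  "offer_one True d n q t = Agenda t q"
| "offer_one False True n q t = Exit"
| "offer_one False False n q t = Agenda (add n t) (n # q)"

fun offer :: "map4 option list \<Rightarrow> agenda \<Rightarrow> unit trie \<Rightarrow> agenda" where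
  "offer rs Exit D = Exit"
| "offer [] (Agenda t q) D = Agenda t q"
| "offer (None # rs) (Agenda t q) D = Exit"
| "offer (Some n # rs) (Agenda t q) D = offer rs (offer_one (mem n t) (mem n D) n q t) D"

fun all_mem :: "bool \<Rightarrow> map4 list \<Rightarrow> unit trie \<Rightarrow> bool" where
  "all_mem False P t = False"
| "all_mem True [] t = True"
| "all_mem True (x # P) t = all_mem (mem x t) P t"

fun fire :: "rule list \<Rightarrow> unit trie \<Rightarrow> map4 option list" where
  "fire [] t = []"
| "fire ((P, r) # B) t = cons_if (all_mem True P t) r (fire B t)"

text \<open>Here \<open>T\<close> is already narrowed to the rules whose key begins with the new map
  \<open>c\<close>. Each \<open>x\<close> contributes both products with \<open>c\<close> and those
  rules keyed by \<open>c\<close> and \<open>x\<close> whose premises have all been derived.\<close>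

fun scan :: "map4 \<Rightarrow> map4 list \<Rightarrow> agenda \<Rightarrow> rule trie \<Rightarrow> unit trie \<Rightarrow> agenda" where
  "scan c X Exit T D = Exit"
| "scan c [] (Agenda t q) T D = Agenda t q"
| "scan c (x # X) (Agenda t q) T D =
    scan c X (offer (Some (nrm (comp x c)) # Some (nrm (comp c x)) # fire (lookup (digits x) T) t)
      (Agenda t q) D) T D"

text \<open>The list \<open>n\<close> only bounds the number of steps. Stopping early is harmless, since the current set is
  reported in any case.\<close>

fun run :: "'a list \<Rightarrow> map4 list \<Rightarrow> agenda \<Rightarrow> unit trie \<Rightarrow> rule trie \<Rightarrow> map4 list list" where
  "run n X Exit D T = []"
| "run n X (Agenda t []) D T = [srt X]"
| "run [] X (Agenda t (c # q)) D T = [srt X]"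
| "run (x # n) X (Agenda t (c # q)) D T =
    run n (c # X) (scan c (c # X) (Agenda t q) (subtrie (digits c) T) D) D T"

text \<open>Precomputes for each map the part of the rule table keyed by it, so that the first scan
  works on a small table.\<close>

fun attach :: "map4 list \<Rightarrow> 'v trie \<Rightarrow> (map4 \<times> 'v trie) list" where
  "attach [] T = []"
| "attach (s # ss) T = (s, subtrie (digits s) T) # attach ss T"

fun attach_groups :: "map4 list list \<Rightarrow> 'v trie \<Rightarrow> (map4 \<times> 'v trie) list list" where
  "attach_groups [] T = []"
| "attach_groups (g # gs) T = attach g T # attach_groups gs T"

type_synonym pending = "map4 list \<times> agenda \<times> unit trie"

fun cons_pending :: "agenda \<Rightarrow> map4 list \<Rightarrow> unit trie \<Rightarrow> pending list \<Rightarrow> pending list" where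
  "cons_pending Exit X D ps = ps"
| "cons_pending (Agenda t q) X D ps = (X, Agenda t q, D) # ps"

text \<open>A map already in \<open>R\<close> yields \<open>Exit\<close>, which
  \<open>cons_pending\<close> discards: there is nothing to extend by.\<close>

fun start :: "bool \<Rightarrow> map4 \<Rightarrow> map4 list \<Rightarrow> unit trie \<Rightarrow> rule trie \<Rightarrow> unit trie \<Rightarrow> agenda" where
  "start True s R t T D = Exit"
| "start False s R t T D = scan s (s # R) (Agenda (add s t) []) T D"

fun extend :: "map4 list \<Rightarrow> unit trie \<Rightarrow> unit trie \<Rightarrow> (map4 \<times> rule trie) list \<Rightarrow> pending list" where
  "extend R t D [] = []"
| "extend R t D ((s, T) # ss) =
    cons_pending (start (mem s t) s R t T D) (s # R) D 
      (extend R t (pick (mem s t) D (add s D)) ss)"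

text \<open>Reproduces the set \<open>D\<close> that \<open>extend\<close> has built up by the end
  of a group, as the starting value for the next group.\<close>

fun skip :: "unit trie \<Rightarrow> unit trie \<Rightarrow> (map4 \<times> 'v trie) list \<Rightarrow> unit trie" where
  "skip t D [] = D"
| "skip t D ((s, T) # ss) = skip t (pick (mem s t) D (add s D)) ss"

fun extend_groups :: "map4 list \<Rightarrow> unit trie \<Rightarrow> unit trie \<Rightarrow> (map4 \<times> rule trie) list list \<Rightarrow>
    pending list" where
  "extend_groups R t D [] = []"
| "extend_groups R t D (g # gs) = extend R t D g @ extend_groups R t (skip t D g) gs"

fun run_all :: "'a list \<Rightarrow> pending list \<Rightarrow> rule trie \<Rightarrow> map4 list list" where
  "run_all n [] T = []"
| "run_all n ((X, a, D) # ps) T = run n X a D T @ run_all n ps T"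

fun queries :: "'a list \<Rightarrow> map4 list list \<Rightarrow> (map4 \<times> rule trie) list list \<Rightarrow> rule trie \<Rightarrow>
    map4 list list" where
  "queries n [] S T = []"
| "queries n (R # Rs) S T =
    run_all n (extend_groups R (add idm (add_all R E)) E S) T @ queries n Rs S T"

fun all_present :: "map4 list list \<Rightarrow> bool \<Rightarrow> unit trie \<Rightarrow> bool" where
  "all_present Ys False L = False"
| "all_present [] True L = True"
| "all_present (Y # Ys) True L = all_present Ys (nonempty (lookup (key Y) L)) L"

text \<open>The empty trace is tested together with the reported sets because the later choice of a
  largest trace starts from it. The list \<open>univ\<close> also serves as the bound on the steps
  of a run.\<close>

fun check :: "map4 list list \<Rightarrow> map4 list list \<Rightarrow> rule trie \<Rightarrow> bool" where
  "check Rs Rs' T =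
    all_present ([] # queries univ Rs' (attach_groups univ_groups T) T) True (closed_sets Rs)"

text \<open>The whole exhaustive search, carried out by evaluation: every set it reports belongs to
  \<open>family\<close>.\<close>

lemma check_tables: "check (stars tables) (stars tables) (rule_table perms)"
  by code_simp

section \<open>Soundness of the search\<close>

lemma all_present: "all_present Ys b L \<longleftrightarrow> b \<and> (\<forall>Y\<in>set Ys. lookup (key Y) L \<noteq> [])"
  by (induction Ys b L rule: all_present.induct) auto

lemma all_mem [simp]: "all_mem b P t \<longleftrightarrow> b \<and> (\<forall>s\<in>set P. mem s t)"
  by (induction b P t rule: all_mem.induct) auto

lemma set_fire: "r \<in> set (fire B t) \<Longrightarrow> \<exists>P. (P, r) \<in> set B \<and> (\<forall>s\<in>set P. mem s t)"
  by (induction B t rule: fire.induct) (auto split: if_splits)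

text \<open>The closure properties of a centraliser from which the search draws its
  conclusions.\<close>

definition good :: "map4 set \<Rightarrow> bool" where
  "good C \<longleftrightarrow> idm \<in> C \<and> (\<forall>s\<in>C. \<forall>t\<in>C. nrm (comp s t) \<in> C) \<and>
     (\<forall>P r. valid (P, r) \<longrightarrow> set P \<subseteq> C \<longrightarrow> (\<exists>n\<in>C. r = Some n))"

text \<open>Nonemptiness matters for contradictions: with \<open>F\<close> empty,
  \<open>cent F\<close> contains the premises of every rule with conclusion
  \<open>None\<close>.\<close>

lemma good_cent:
  assumes "F \<noteq> {}" "\<And>f. f \<in> F \<Longrightarrow> maj f"
  shows "good (cent F)"
  unfolding good_def
proof (intro conjI allI impI ballI)
  show "idm \<in> cent F"
    by (simp add: cent_def com_idm)
  show "nrm (comp s t) \<in> cent F" if "s \<in> cent F" "t \<in> cent F" for s t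
    using that assms(2) by (auto simp: cent_def com_nrm com_comp)
  show "\<exists>n\<in>cent F. r = Some n" if "valid (P, r)" "set P \<subseteq> cent F" for P r
  proof -
    have *: "\<exists>n. r = Some n \<and> com f n" if f: "f \<in> F" for f
    proof -
      have "\<forall>s\<in>set P. com f s"
        using \<open>set P \<subseteq> cent F\<close> f unfolding cent_def by blast
      then show ?thesis
        using \<open>valid (P, r)\<close> assms(2)[OF f] unfolding valid_def fst_conv snd_conv by blast
    qed
    then obtain n where "r = Some n"
      using assms(1) by blast
    then show ?thesis
      using * by (simp add: cent_def)
  qed
qed

definition valid_table :: "rule trie \<Rightarrow> bool" where
  "valid_table T \<longleftrightarrow> (\<forall>k. \<forall>r\<in>set (lookup k T). valid r)"

lemma valid_table_subtrie: "valid_table T \<Longrightarrow> valid_table (subtrie k T)"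
  by (simp add: valid_table_def)

lemma valid_table_upd: "valid r \<Longrightarrow> valid_table T \<Longrightarrow> valid_table (upd k r T)"
  by (simp add: valid_table_def)

lemma valid_table_E: "valid_table E"
  by (simp add: valid_table_def)

lemma valid_table_add_rule: "valid r \<Longrightarrow> valid_table T \<Longrightarrow> valid_table (add_rule r T)"
proof (induction r T rule: add_rule.induct)
  case (2 x xs r T)
  have "valid_table (add_rotations X z r' T)" if "valid r'" "valid_table T" for X z and r' :: rule
    using that by (induction X z r' T rule: add_rotations.induct) (auto intro: valid_table_upd)
  then show ?case
    using 2 by simp
qed simp

lemma valid_rule_table: "valid_table (rule_table perms)"
proof -
  have 1: "valid_table (conjugate_rules p q rs)" if "inverse_pair p q" "\<forall>r\<in>set rs. valid r" for p q rs
    using that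
    by (induction rs) (auto intro: valid_table_add_rule valid_conjugate valid_table_E)
  have 2: "valid_table (rule_table ps)" if "\<forall>(p, q)\<in>set ps. inverse_pair p q" for ps
    using that
  proof (induction ps rule: rule_table.induct)
    case (2 p q ps)
    then show ?case
      using 1[of p q rules] rules_valid by (auto simp: valid_table_def)
  qed (simp add: valid_table_E)
  show ?thesis
    using perms_inverse by (intro 2) auto
qed

text \<open>Here \<open>G\<close> is the claim to be proved, and membership of a map of \<open>D\<close> in \<open>C\<close> implies it.\<close>

definition handled :: "unit trie \<Rightarrow> map4 set \<Rightarrow> bool \<Rightarrow> bool" where
  "handled D C G \<longleftrightarrow> (\<forall>s\<in>C. mem s D \<longrightarrow> G)"

text \<open>The invariant of the search: everything derived lies in \<open>C\<close>, and stopping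
  is justified only by the claim \<open>G\<close>.\<close>

fun sound :: "map4 set \<Rightarrow> bool \<Rightarrow> agenda \<Rightarrow> bool" where
  "sound C G Exit \<longleftrightarrow> G"
| "sound C G (Agenda t q) \<longleftrightarrow> (\<forall>s. mem s t \<longrightarrow> s \<in> C) \<and> set q \<subseteq> C"

text \<open>The hypothesis on \<open>rs\<close> rules out contradictions, so \<open>Exit\<close> can
  arise only from a derived map that lies in \<open>D\<close>, and that implies
  \<open>G\<close>.\<close>

lemma sound_offer:
  assumes "handled D C G"
  shows "sound C G a \<Longrightarrow> \<forall>r\<in>set rs. \<exists>n\<in>C. r = Some n \<Longrightarrow> sound C G (offer rs a D)"
proof (induction rs arbitrary: a)
  case Nil
  then show ?case by (cases a) auto
next
  case (Cons r rs)
  obtain n where n: "r = Some n" "n \<in> C"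
    using Cons.prems by auto
  show ?case
  proof (cases a)
    case (Agenda t q)
    have "sound C G (offer_one (mem n t) (mem n D) n q t)"
      using Cons.prems(1) n assms unfolding Agenda
      by (cases "mem n t"; cases "mem n D") (auto simp: handled_def)
    then show ?thesis
      using Cons n Agenda by simp
  qed (use Cons in simp)
qed

lemma sound_scan:
  assumes C: "good C" and "handled D C G" "valid_table T" "c \<in> C"
  shows "sound C G a \<Longrightarrow> set X \<subseteq> C \<Longrightarrow> sound C G (scan c X a T D)"
proof (induction X arbitrary: a)
  case Nil
  then show ?case by (cases a) auto
next
  case (Cons x X)
  show ?case
  proof (cases a)
    case (Agenda t q)
    have fired: "\<exists>n\<in>C. r = Some n" if r: "r \<in> set (fire (lookup (digits x) T) t)" for r
    proof -
      obtain P where P: "(P, r) \<in> set (lookup (digits x) T)" "\<forall>s\<in>set P. mem s t"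
        using set_fire[OF r] by blast
      then have "set P \<subseteq> C" "valid (P, r)"
        using Cons.prems(1) assms(3) by (auto simp: Agenda valid_table_def)
      then show ?thesis
        using C unfolding good_def by blast
    qed
    have "nrm (comp x c) \<in> C" "nrm (comp c x) \<in> C"
      using C Cons.prems(2) assms(4) by (auto simp: good_def)
    then have "sound C G (offer (Some (nrm (comp x c)) # Some (nrm (comp c x)) #
        fire (lookup (digits x) T) t) a D)"
      using fired Cons.prems(1) by (intro sound_offer[OF assms(2)]) auto
    then show ?thesis
      using Cons Agenda by simp
  qed (use Cons in simp)
qed

text \<open>The reported set need not be closed. It suffices that it contains \<open>X\<close>,
  stays inside \<open>C\<close> and, by the last assumption, belongs to
  \<open>family\<close>.\<close>

lemma run_sound:
  assumes "good C" "handled D C G" "valid_table T"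
  shows "sound C G a \<Longrightarrow> set X \<subseteq> C \<Longrightarrow> set (run n X a D T) \<subseteq> family \<Longrightarrow>
    G \<or> (\<exists>Y\<in>family. set X \<subseteq> set Y \<and> set Y \<subseteq> C)"
proof (induction n arbitrary: X a)
  case Nil
  have "G \<or> srt X \<in> family"
    using Nil by (cases a rule: agenda.exhaust; cases "case a of Agenda t q \<Rightarrow> q") auto
  then show ?case
    using Nil(2) by (metis order_refl set_srt)
next
  case (Cons x n)
  consider "a = Exit" | t where "a = Agenda t []" | t c q where "a = Agenda t (c # q)"
    by (metis agenda.exhaust list.exhaust)
  then show ?case
  proof cases
    case 2
    then have "srt X \<in> family"
      using Cons.prems by simp
    then show ?thesis
      using Cons.prems(2) by (metis order_refl set_srt)
  next
    case 3
    then have c: "c \<in> C"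
      using Cons.prems(1) by simp
    have "sound C G (Agenda t q)"
      using Cons.prems(1) 3 by simp
    then have "sound C G (scan c (c # X) (Agenda t q) (subtrie (digits c) T) D)"
      using Cons.prems(2) c
      by (intro sound_scan[OF assms(1,2) valid_table_subtrie[OF assms(3)] c]) simp_all
    then have "G \<or> (\<exists>Y\<in>family. set (c # X) \<subseteq> set Y \<and> set Y \<subseteq> C)"
      using Cons.prems(2,3) c 3 by (intro Cons.IH) (auto simp del: scan.simps)
    then show ?thesis by auto
  qed (use Cons in simp)
qed

definition extendable :: "map4 set \<Rightarrow> map4 list \<Rightarrow> bool" where
  "extendable C R \<longleftrightarrow> (\<exists>Y\<in>family. set R \<subset> set Y \<and> set Y \<subseteq> C)"

text \<open>Stated as an implication because its hypothesis on \<open>D\<close> becomes available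
  only in the induction over the maps treated earlier.\<close>

fun resolved :: "map4 set \<Rightarrow> map4 list \<Rightarrow> pending \<Rightarrow> bool" where
  "resolved C R (X, a, D) \<longleftrightarrow> (handled D C (extendable C R) \<longrightarrow> sound C (extendable C R) a \<longrightarrow>
     set X \<subseteq> C \<longrightarrow> set R \<subset> set X \<longrightarrow> extendable C R)"

lemma resolved_run_all:
  assumes "good C" "valid_table T" "set (run_all n ps T) \<subseteq> family" "p \<in> set ps"
  shows "resolved C R p"
proof (cases p)
  case (fields X a D)
  have sub: "set (run n X a D T) \<subseteq> family"
    using assms(3,4) unfolding fields by (induction ps) auto
  show ?thesis
    unfolding fields resolved.simps
  proof (intro impI)
    assume "handled D C (extendable C R)" "sound C (extendable C R) a" "set X \<subseteq> C" "set R \<subset> set X"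
    moreover from this have
      "extendable C R \<or> (\<exists>Y\<in>family. set X \<subseteq> set Y \<and> set Y \<subseteq> C)"
      using run_sound[OF assms(1) _ assms(2) _ _ sub] by blast
    ultimately show "extendable C R"
      unfolding extendable_def by (meson psubset_subset_trans)
  qed
qed

context
  fixes C R t
  assumes C: "good C" and R: "set R \<subseteq> C" and t: "\<And>s. mem s t \<longleftrightarrow> s = idm \<or> s \<in> set R"
begin

text \<open>Induction in the order of treatment: once \<open>s\<close> is shown to force an
  extension it may enter \<open>D\<close>, and later searches may stop on deriving it.\<close>

lemma handled_extend:
  "\<forall>(s, T)\<in>set ss. valid_table T \<Longrightarrow> \<forall>p\<in>set (extend R t D ss). resolved C R p \<Longrightarrow>
    handled D C (extendable C R) \<Longrightarrow>
    handled (skip t D ss) C (extendable C R) \<and>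
    (\<forall>(s, T)\<in>set ss. s \<in> C \<longrightarrow> mem s t \<or> extendable C R)"
proof (induction ss arbitrary: D)
  case (Cons p ss)
  obtain s T where p: "p = (s, T)"
    by (cases p)
  let ?D = "pick (mem s t) D (add s D)"
  have rest: "\<forall>p\<in>set (extend R t ?D ss). resolved C R p"
    using Cons.prems(2) unfolding p by (cases "start (mem s t) s R t T D") auto
  \<comment> \<open>The search from \<open>s\<close> uses the old \<open>D\<close>, without
    \<open>s\<close>. It either stops, which already gives the claim, or is pending and hence
    resolved.\<close>
  have new: "extendable C R" if s: "s \<in> C" "\<not> mem s t"
  proof -
    let ?a = "scan s (s # R) (Agenda (add s t) []) T D"
    have "idm \<in> C"
      using C by (simp add: good_def)
    then have "sound C (extendable C R) (Agenda (add s t) [])"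
      using s(1) R by (auto simp: t)
    then have a: "sound C (extendable C R) ?a"
      using sound_scan[OF C Cons.prems(3) _ s(1), of T "Agenda (add s t) []" "s # R"]
        Cons.prems(1) s(1) R by (simp add: p del: scan.simps)
    show ?thesis
    proof (cases ?a)
      case (Agenda t' q)
      then have "resolved C R (s # R, ?a, D)"
        using Cons.prems(2) s(2) by (simp add: p del: scan.simps resolved.simps)
      moreover have "set (s # R) \<subseteq> C" "set R \<subset> set (s # R)"
        using s R by (auto simp: t)
      ultimately show ?thesis
        using a Cons.prems(3) unfolding resolved.simps by blast
    qed (use a in simp)
  qed
  then have "handled ?D C (extendable C R)"
    using Cons.prems(3) by (auto simp: handled_def)
  then show ?case
    using Cons.IH[OF _ rest] Cons.prems(1) new by (auto simp: p)
qed simp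

lemma handled_extend_groups:
  "\<forall>g\<in>set gs. \<forall>(s, T)\<in>set g. valid_table T \<Longrightarrow>
    \<forall>p\<in>set (extend_groups R t D gs). resolved C R p \<Longrightarrow> handled D C (extendable C R) \<Longrightarrow>
    g \<in> set gs \<Longrightarrow> (s, T) \<in> set g \<Longrightarrow> s \<in> C \<Longrightarrow> mem s t \<or> extendable C R"
proof (induction gs arbitrary: D)
  case (Cons h gs)
  have h: "\<forall>(s, T)\<in>set h. valid_table T" "\<forall>p\<in>set (extend R t D h). resolved C R p"
    using Cons.prems(1,2) by auto
  note ext = handled_extend[OF h Cons.prems(3)]
  show ?case
  proof (cases "g = h")
    case True
    then show ?thesis
      using ext Cons.prems(5,6) by blast
  next
    case False
    show ?thesis
      by (rule Cons.IH[OF _ _ conjunct1[OF ext] _ Cons.prems(5,6)])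
        (use Cons.prems(1,2,4) False in auto)
  qed
qed simp

end

lemma set_attach_groups: "set (attach_groups gs T) = (\<lambda>g. attach g T) ` set gs"
  by (induction gs) auto

lemma set_attach: "set (attach g T) = (\<lambda>s. (s, subtrie (digits s) T)) ` set g"
  by (induction g) auto

lemma extendableI:
  assumes "set (queries n Rs (attach_groups univ_groups T) T) \<subseteq> family" "valid_table T"
    and "R \<in> set Rs" "good C" "set R \<subseteq> C" "s \<in> C" "s \<in> set univ" "s \<notin> set R"
  shows "extendable C R"
proof -
  let ?t = "add idm (add_all R E)" and ?S = "attach_groups univ_groups T"
  have "set (run_all n (extend_groups R ?t E ?S) T) \<subseteq> family"
    using assms(1,3) by (induction Rs) auto
  then have res: "\<forall>p\<in>set (extend_groups R ?t E ?S). resolved C R p"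
    using resolved_run_all[OF assms(4,2)] by blast
  obtain g where g: "g \<in> set univ_groups" "s \<in> set g"
    using assms(7) by (auto simp: univ_def)
  have "mem s ?t \<or> extendable C R"
  proof (rule handled_extend_groups[OF assms(4,5) _ _ res])
    show "attach g T \<in> set ?S" "(s, subtrie (digits s) T) \<in> set (attach g T)"
      using g by (auto simp: set_attach_groups set_attach)
  qed (auto simp: set_attach_groups set_attach valid_table_subtrie assms handled_def)
  then show ?thesis
    using assms(7,8) by (auto simp: set_univ_iff)
qed

lemma queries_family:
  "set (queries univ (stars tables) (attach_groups univ_groups (rule_table perms))
    (rule_table perms)) \<subseteq> family" and Nil_family: "[] \<in> family"
  using check_tables unfolding check.simps all_present lookup_closed_sets by auto

section \<open>Counting\<close>

text \<open>A largest member of \<^const>\<open>family\<close> contained in \<^term>\<open>cent F\<close> is conjugate to one of the stars, and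
  these cannot be extended properly within a conjugate of \<^term>\<open>cent F\<close>.\<close>

lemma cent_eq_gen:
  assumes "F \<noteq> {}" and F: "\<And>f. f \<in> F \<Longrightarrow> maj f"
  obtains Y where "Y \<in> family" "cent F = gen Y"
proof -
  let ?P = "\<lambda>Y. Y \<in> family \<and> set Y \<subseteq> cent F"
  have "\<forall>Y. ?P Y \<longrightarrow> card (set Y) < Suc (card (set univ))"
    using family_univ by (simp add: card_mono less_Suc_eq_le)
  moreover have "?P []"
    using Nil_family by simp
  \<comment> \<open>Traces in \<open>family\<close> are subsets of the finite \<open>univ\<close>
    and \<open>[]\<close> is a candidate, so one of largest size exists.\<close>
  ultimately obtain Y where Y: "Y \<in> family" "set Y \<subseteq> cent F"
    and max: "\<And>Z. Z \<in> family \<Longrightarrow> set Z \<subseteq> cent F \<Longrightarrow> card (set Z) \<le> card (set Y)"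
    using ex_has_greatest_nat[of ?P "[]" "\<lambda>Y. card (set Y)"] by metis
  obtain p q R where pq: "(p, q) \<in> set perms" and R: "R \<in> set (stars tables)"
    and "Y = srt (map (conjugate p q) R)"
    using Y(1) unfolding family_def by blast
  then have set_Y: "set Y = conjugate p q ` set R"
    by simp
  note pq' = perms_inverse[OF pq]
  note qp = inverse_pair_sym[OF pq']
  have R_univ: "set R \<subseteq> set univ"
    using R by (auto simp: set_stars set_star[OF maj_wit])
  have cent_twist: "s \<in> cent (twist p q ` F) \<longleftrightarrow> conjugate p q s \<in> cent F" for s
    using com_conjugate[OF pq' F] by (auto simp: cent_def)
  have good: "good (cent (twist p q ` F))"
    using assms maj_twist[OF pq'] by (intro good_cent) auto
  have "cent F \<subseteq> gen Y"
  proof (intro subsetI, rule ccontr)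
    fix s assume s: "s \<in> cent F" and not: "s \<notin> gen Y"
    let ?s = "conjugate q p s"
    have s': "conjugate p q ?s = nrm s"
      by (rule conjugate_conjugate[OF pq'])
    have "nrm s \<in> cent F"
      using s F by (auto simp: cent_def com_nrm)
    then have "?s \<in> cent (twist p q ` F)"
      by (simp add: cent_twist s')
    moreover have "?s \<notin> set R"
      using not set_Y s' by (auto simp: gen_def image_iff)
    moreover have "?s \<in> set univ"
      using not conjugate_eq_idm[OF qp, of s] by (auto simp: set_univ_iff gen_def)
    moreover have "set R \<subseteq> cent (twist p q ` F)"
      using Y(2) set_Y cent_twist by auto
    ultimately have "extendable (cent (twist p q ` F)) R"
      using extendableI[OF queries_family valid_rule_table R good] by blast
    then obtain Z where Z: "Z \<in> family" "set R \<subset> set Z" "set Z \<subseteq> cent (twist p q ` F)"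
      by (auto simp: extendable_def)
    \<comment> \<open>Conjugation is injective on \<open>univ\<close>, so moving \<open>Z\<close>
      back gives a member of \<open>family\<close> inside \<open>cent F\<close> that is larger than
      \<open>Y\<close>.\<close>
    have "card (conjugate p q ` set Z) \<le> card (set Y)"
      using max[OF family_conjugate[OF pq Z(1)]] Z(3) cent_twist by auto
    also have "\<dots> = card (set R)"
      unfolding set_Y using inj_on_conjugate[OF pq'] R_univ by (metis card_image inj_on_subset)
    also have "\<dots> < card (set Z)"
      using Z(2) by (simp add: psubset_card_mono)
    also have "\<dots> = card (conjugate p q ` set Z)"
      using inj_on_conjugate[OF pq'] family_univ[OF Z(1)] by (metis card_image inj_on_subset)
    finally show False
      by simp
  qed
  moreover have "gen Y \<subseteq> cent F"
  proof
    fix s assume "s \<in> gen Y"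
    then have "nrm s \<in> cent F"
      using Y(2) by (auto simp: gen_def cent_def com_idm)
    then show "s \<in> cent F"
      using F by (auto simp: cent_def com_nrm)
  qed
  ultimately show thesis
    using that Y(1) by blast
qed

text \<open>Any rule with conclusion \<open>None\<close> refutes this. It separates the full
  transformation monoid from the 1714 others.\<close>

lemma no_maj_commutes_with_all:
  assumes "maj f"
  shows "cent {f} \<noteq> UNIV"
proof
  assume "cent {f} = UNIV"
  moreover have "\<exists>P. (P, None) \<in> set rules"
    by (auto simp: rules_def short_rules_def)
  ultimately show False
    using assms rules_valid by (fastforce simp: valid_def cent_def)
qed

text \<open>The empty \<open>F\<close> gives \<open>UNIV\<close>, a nonempty \<open>F\<close> gives
  \<open>gen Y\<close> with \<open>Y\<close> in \<open>family\<close>, and each such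
  \<open>gen Y\<close> comes from a single operation.\<close>

lemma card_cent: "card (cent ` {F. F \<subseteq> Collect maj}) = 1715"
proof -
  have "cent ` {F. F \<subseteq> Collect maj} = insert UNIV (gen ` family)" (is "?L = ?R")
  proof
    show "?L \<subseteq> ?R"
    proof (rule image_subsetI)
      fix F assume F: "F \<in> {F. F \<subseteq> Collect maj}"
      show "cent F \<in> ?R"
      proof (cases "F = {}")
        case True
        then show ?thesis by (simp add: cent_def)
      next
        case False
        then show ?thesis
          using cent_eq_gen[of F] F by blast
      qed
    qed
    have "UNIV \<in> ?L"
      by (rule image_eqI[of _ _ "{}"]) (simp_all add: cent_def)
    moreover have "gen Y \<in> ?L" if Y: "Y \<in> family" for Y
    proof -
      obtain f where "maj f" "cent {f} = gen Y"
        using family_cent[OF Y] by metis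
      then show ?thesis
        by (intro image_eqI[of _ _ "{f}"]) simp_all
    qed
    ultimately show "?R \<subseteq> ?L"
      by blast
  qed
  moreover have "UNIV \<notin> gen ` family"
    using family_cent no_maj_commutes_with_all by (metis imageE)
  moreover have "card (gen ` family) = 1714"
    using card_family gen_inject by (simp add: card_image inj_on_def)
  ultimately show ?thesis
    using card_family(1) by simp
qed

section \<open>Transfer to the carrier of natural numbers\<close>

fun enc :: "four \<Rightarrow> nat" where
  "enc A0 = 0" | "enc A1 = 1" | "enc A2 = 2" | "enc A3 = 3"

text \<open>Numbers outside the carrier go to \<open>A3\<close> only to make the function total; it
  inverts \<open>enc\<close> on the carrier.\<close>

definition dec :: "nat \<Rightarrow> four" where
  "dec n = (if n = 0 then A0 else if n = 1 then A1 else if n = 2 then A2 else A3)"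

definition carrier :: "nat set" where
  "carrier = {0, 1, 2, 3}"

lemma dec_enc [simp]: "dec (enc x) = x"
  by (cases x) (simp_all add: dec_def)

lemma enc_dec [simp]: "n \<in> carrier \<Longrightarrow> enc (dec n) = n"
  by (auto simp: carrier_def dec_def)

lemma enc_carrier [simp]: "enc x \<in> carrier"
  by (cases x) (simp_all add: carrier_def)

lemma ball_carrier: "(\<forall>n\<in>carrier. P n) \<longleftrightarrow> (\<forall>x. P (enc x))"
  unfolding all_four by (simp add: carrier_def)

definition operation :: "op3 \<Rightarrow> nat \<times> nat \<times> nat \<Rightarrow> nat" where
  "operation f = (\<lambda>(x, y, z)\<in>carrier \<times> carrier \<times> carrier. enc (f (dec x) (dec y) (dec z)))"

definition mapping :: "map4 \<Rightarrow> nat \<Rightarrow> nat" where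
  "mapping s = (\<lambda>x\<in>carrier. enc (ap s (dec x)))"

lemma operation_enc: "operation f (enc x, enc y, enc z) = enc (f x y z)"
  by (simp add: operation_def)

lemma mapping_enc: "mapping s (enc x) = enc (ap s x)"
  by (simp add: mapping_def)

lemma enc_inject: "enc x = enc y \<longleftrightarrow> x = y"
  by (metis dec_enc)

lemma inj_mapping: "inj mapping"
  by (intro injI map4_eqI) (metis mapping_enc enc_inject)

lemma range_mapping: "range mapping = carrier \<rightarrow>\<^sub>E carrier"
proof
  show "range mapping \<subseteq> carrier \<rightarrow>\<^sub>E carrier"
    by (auto simp: mapping_def)
  show "carrier \<rightarrow>\<^sub>E carrier \<subseteq> range mapping"
  proof
    fix g assume g: "g \<in> carrier \<rightarrow>\<^sub>E carrier"
    let ?s = "M (dec (g 0)) (dec (g 1)) (dec (g 2)) (dec (g 3))"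
    have "mapping ?s = g"
    proof (rule PiE_ext)
      show "mapping ?s \<in> carrier \<rightarrow>\<^sub>E carrier"
        using \<open>range mapping \<subseteq> _\<close> by blast
      fix n assume n: "n \<in> carrier"
      then have "ap ?s (dec n) = dec (g n)"
        by (auto simp: carrier_def dec_def)
      moreover have "g n \<in> carrier"
        using g n by (rule PiE_mem)
      ultimately show "mapping ?s n = g n"
        using n by (simp add: mapping_def)
    qed (rule g)
    then show "g \<in> range mapping"
      by (metis rangeI)
  qed
qed

lemma operation_PiE: "operation f \<in> carrier \<times> carrier \<times> carrier \<rightarrow>\<^sub>E carrier"
  by (auto simp: operation_def)

lemma Maj_carrier: "Maj carrier = operation ` Collect maj"
proof
  show "operation ` Collect maj \<subseteq> Maj carrier"
    unfolding Maj_def ball_carrier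
    by (intro image_subsetI CollectI conjI allI operation_PiE)
       (simp_all only: operation_enc maj_def mem_Collect_eq)
  show "Maj carrier \<subseteq> operation ` Collect maj"
  proof
    fix g assume g: "g \<in> Maj carrier"
    let ?f = "\<lambda>x y z. dec (g (enc x, enc y, enc z))"
    have g': "g \<in> carrier \<times> carrier \<times> carrier \<rightarrow>\<^sub>E carrier"
      using g unfolding Maj_def by blast
    have "\<forall>x y. g (enc x, enc x, enc y) = enc x \<and> g (enc x, enc y, enc x) = enc x \<and>
        g (enc y, enc x, enc x) = enc x"
      using g unfolding Maj_def ball_carrier by blast
    then have "maj ?f"
      by (simp add: maj_def)
    moreover have "operation ?f = g"
    proof (rule PiE_ext[OF operation_PiE g'])
      fix t assume t: "t \<in> carrier \<times> carrier \<times> carrier"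
      obtain x y z where xyz: "t = (x, y, z)"
        by (cases t)
      have "g t \<in> carrier"
        using g' t by (rule PiE_mem)
      then show "operation ?f t = g t"
        using t by (auto simp: operation_def xyz)
    qed
    ultimately show "g \<in> operation ` Collect maj"
      by (intro image_eqI[of _ _ ?f]) simp_all
  qed
qed

lemma commutes_carrier: "commutes carrier (operation f) (mapping s) \<longleftrightarrow> com f s"
  unfolding commutes_def ball_carrier
  by (simp add: operation_enc mapping_enc enc_inject com_def)

text \<open>By \<open>range_mapping\<close> every extensional map on the carrier is some
  \<open>mapping s\<close>, so no element of the centraliser is lost.\<close>

lemma unary_centraliser_carrier: "unary_centraliser carrier (operation ` F) = mapping ` cent F"
  unfolding unary_centraliser_def range_mapping[symmetric]
  by (auto simp: cent_def commutes_carrier)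

lemma maj_centralising_monoids_carrier:
  "maj_centralising_monoids carrier = image mapping ` cent ` {F. F \<subseteq> Collect maj}"
proof -
  have "{F. F \<subseteq> Maj carrier} = image operation ` {F. F \<subseteq> Collect maj}"
    unfolding Maj_carrier by (auto simp: subset_image_iff)
  moreover have "maj_centralising_monoids carrier = unary_centraliser carrier ` {F. F \<subseteq> Maj carrier}"
    by (auto simp: maj_centralising_monoids_def)
  ultimately show ?thesis
    by (simp add: image_image unary_centraliser_carrier)
qed

theorem corollary5p2:
  "card (maj_centralising_monoids {0, 1, 2, 3 :: nat}) = 1715"
proof -
  \<comment> \<open>Injectivity on sets of maps is what is needed, since the objects counted are
    monoids.\<close>
  have "inj (image mapping)"
    using inj_mapping by (simp add: inj_image_eq_iff inj_def)
  then have "card (maj_centralising_monoids carrier) = 1715"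
    unfolding maj_centralising_monoids_carrier using card_cent
    by (subst card_image) (auto intro: inj_on_subset)
  then show ?thesis
    by (simp only: carrier_def)
qed

end
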